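(* Let $\gamma$ be a smooth simple closed curve in the affine plane with strictly positive equi-affine curvature $\kappa$. Then each of the following holds: (i) $\gamma$ is a critical point of $\int\sqrt{\kappa}\,\mathrm{d}s$ if and only if $\gamma$ is an ellipse; (ii) $\gamma$ is a critical point of $\int\sqrt{\kappa}\,\mathrm{d}s$ under area constraint if and only if $\gamma$ is an ellipse; (iii) $\gamma$ is a critical point of $\int\sqrt{\kappa}\,\mathrm{d}s$ under equi-affine arc-length constraint if and only if $\gamma$ is an ellipse; (iv) $\gamma$ is a critical point of $\int\sqrt{\kappa}\,\mathrm{d}s$ under total equi-affine curvature constraint if and only if $\gamma$ is an ellipse. (That is, among simple closed strictly positively curved curves, the ellipses are the only critical points in each of these four variational problems.)
   Context: The affine plane is $\mathbb{R}^2$ with area form $|u,v|=\det(u,v)$. The curve is parametrised by equi-affine arc-length $s$ ($|\gamma',\gamma''|=1$); the equi-affine curvature is defined by $\gamma'''=-\kappa\gamma'$, and strictly positively curved means $\kappa>0$. Variations are smooth variations of the closed curve within strictly positively curved curves; for a variation with vector field $fN+gT$ ($T=\gamma'$, $N=\gamma''$) the enclosed area changes to first order by $\delta\,\mathrm{Area}=-\int f\,\mathrm{d}s$. A critical point of $\int\sqrt{\kappa}\,\mathrm{d}s$ under the constraint of a functional $G$ (area, total equi-affine arc-length $\int\mathrm{d}s$, or total equi-affine curvature $\int\kappa\,\mathrm{d}s$) means there exists a constant $\lambda$ with $\delta\int\sqrt{\kappa}\,\mathrm{d}s=\lambda\,\delta G$ for all variations; an (unconstrained) critical point means $\delta\int\sqrt{\kappa}\,\mathrm{d}s=0$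 for all variations. *)

theory Defs
  imports "HOL-Analysis.Analysis"
begin

definition area_form :: "real \<times> real \<Rightarrow> real \<times> real \<Rightarrow> real" where
  "area_form u v = fst u * snd v - snd u * fst v"

definition vd :: "(real \<Rightarrow> real \<times> real) \<Rightarrow> real \<Rightarrow> real \<times> real" where
  "vd f t = vector_derivative f (at t)"

definition smooth_curve :: "(real \<Rightarrow> real \<times> real) \<Rightarrow> bool" where
  "smooth_curve c \<longleftrightarrow> (\<forall>k t. ((vd ^^ k) c) differentiable (at t))"

definition periodic_curve :: "(real \<Rightarrow> real \<times> real) \<Rightarrow> real \<Rightarrow> bool" where
  "periodic_curve c P \<longleftrightarrow> (\<forall>t. c (t + P) = c t)"

fun Ck2 :: "nat \<Rightarrow> (real \<times> real \<Rightarrow> real \<times> real) \<Rightarrow> bool" where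
  "Ck2 0 F = continuous_on UNIV F"
| "Ck2 (Suc k) F = (\<exists>D1 D2.
      (\<forall>p. ((\<lambda>u. F (u, snd p)) has_vector_derivative D1 p) (at (fst p)) \<and>
           ((\<lambda>v. F (fst p, v)) has_vector_derivative D2 p) (at (snd p))) \<and>
      Ck2 k F \<and> Ck2 k D1 \<and> Ck2 k D2)"

definition smooth2 :: "(real \<times> real \<Rightarrow> real \<times> real) \<Rightarrow> bool" where
  "smooth2 F \<longleftrightarrow> (\<forall>k. Ck2 k F)"

text \<open>Equi-affine quantities of a curve in an arbitrary regular parametrisation t:
  ds = |c',c''|^(1/3) dt, d/ds = |c',c''|^(-1/3) d/dt, T = dc/ds, N = dT/ds,
  and the equi-affine curvature kappa = |N, dN/ds| (equivalently dN/ds = -kappa T).\<close>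
definition affine_speed :: "(real \<Rightarrow> real \<times> real) \<Rightarrow> real \<Rightarrow> real" where
  "affine_speed c t = area_form (vd c t) (vd (vd c) t)"

definition Ds :: "(real \<Rightarrow> real \<times> real) \<Rightarrow> (real \<Rightarrow> real \<times> real) \<Rightarrow> real \<Rightarrow> real \<times> real" where
  "Ds c f t = (1 / (affine_speed c t powr (1/3))) *\<^sub>R vd f t"

definition aff_T :: "(real \<Rightarrow> real \<times> real) \<Rightarrow> real \<Rightarrow> real \<times> real" where
  "aff_T c = Ds c c"

definition aff_N :: "(real \<Rightarrow> real \<times> real) \<Rightarrow> real \<Rightarrow> real \<times> real" where
  "aff_N c = Ds c (aff_T c)"

definition aff_curv :: "(real \<Rightarrow> real \<times> real) \<Rightarrow> real \<Rightarrow> real" where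
  "aff_curv c t = area_form (aff_N c t) (Ds c (aff_N c) t)"

definition strictly_pos_curved :: "(real \<Rightarrow> real \<times> real) \<Rightarrow> bool" where
  "strictly_pos_curved c \<longleftrightarrow> (\<forall>t. affine_speed c t > 0 \<and> aff_curv c t > 0)"

definition total_sqrt_curv :: "real \<Rightarrow> (real \<Rightarrow> real \<times> real) \<Rightarrow> real" where
  "total_sqrt_curv P c = integral {0..P} (\<lambda>t. sqrt (aff_curv c t) * affine_speed c t powr (1/3))"

definition affine_length :: "real \<Rightarrow> (real \<Rightarrow> real \<times> real) \<Rightarrow> real" where
  "affine_length P c = integral {0..P} (\<lambda>t. affine_speed c t powr (1/3))"

definition total_curv :: "real \<Rightarrow> (real \<Rightarrow> real \<times> real) \<Rightarrow> real" where
  "total_curv P c = integral {0..P} (\<lambda>t. aff_curv c t * affine_speed c t powr (1/3))"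

text \<open>Enclosed (signed) area, positive for the positively oriented curves considered.\<close>
definition enclosed_area :: "real \<Rightarrow> (real \<Rightarrow> real \<times> real) \<Rightarrow> real" where
  "enclosed_area P c = integral {0..P} (\<lambda>t. area_form (c t) (vd c t) / 2)"

definition admissible_variation ::
  "(real \<Rightarrow> real \<Rightarrow> real \<times> real) \<Rightarrow> (real \<Rightarrow> real \<times> real) \<Rightarrow> real \<Rightarrow> bool" where
  "admissible_variation \<Gamma> \<gamma> P \<longleftrightarrow>
     smooth2 (\<lambda>(e, t). \<Gamma> e t) \<and> \<Gamma> 0 = \<gamma> \<and>
     (\<forall>e. periodic_curve (\<Gamma> e) P) \<and>
     (\<exists>\<delta>>0. \<forall>e. \<bar>e\<bar> < \<delta> \<longrightarrow> strictly_pos_curved (\<Gamma> e))"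

definition critical_point ::
  "(real \<Rightarrow> (real \<Rightarrow> real \<times> real) \<Rightarrow> real) \<Rightarrow> (real \<Rightarrow> real \<times> real) \<Rightarrow> real \<Rightarrow> bool" where
  "critical_point F \<gamma> P \<longleftrightarrow>
     (\<forall>\<Gamma>. admissible_variation \<Gamma> \<gamma> P \<longrightarrow> deriv (\<lambda>e. F P (\<Gamma> e)) 0 = 0)"

definition critical_point_under ::
  "(real \<Rightarrow> (real \<Rightarrow> real \<times> real) \<Rightarrow> real) \<Rightarrow> (real \<Rightarrow> (real \<Rightarrow> real \<times> real) \<Rightarrow> real)
    \<Rightarrow> (real \<Rightarrow> real \<times> real) \<Rightarrow> real \<Rightarrow> bool" where
  "critical_point_under F G \<gamma> P \<longleftrightarrow>
     (\<exists>lam. \<forall>\<Gamma>. admissible_variation \<Gamma> \<gamma> P \<longrightarrow>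
        deriv (\<lambda>e. F P (\<Gamma> e)) 0 = lam * deriv (\<lambda>e. G P (\<Gamma> e)) 0)"

definition is_ellipse :: "(real \<Rightarrow> real \<times> real) \<Rightarrow> bool" where
  "is_ellipse c \<longleftrightarrow> (\<exists>x0 y0 a b p q. a * q - b * p \<noteq> 0 \<and>
     range c = {(x0 + a * cos \<theta> + b * sin \<theta>, y0 + p * cos \<theta> + q * sin \<theta>) | \<theta>. True})"

end

(* Write p = kappa^(-1/2). For a variation f N of a unit speed curve, the first variation of the
   integral of sqrt kappa is 1/6 times the integral of f (p'''' + kappa p''), so that constrained
   critical points satisfy p'''' + kappa p'' = c g with g = 1 (area), g = kappa (length) or
   g = kappa'' + kappa^2 (total curvature). In each case g = h'' + kappa h with h the support
   function |gamma - gamma(s), T|, h = 1, h = kappa respectively. Hence w = p'' - c h solves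
   w'' = - kappa w, so w is a constant combination of the components of T and integrates to 0.
   This forces c = 0 unless the integral of h vanishes; for area that integral is twice the enclosed
   area, which is positive because the tangent of a simple closed curve turns only once. With c = 0,
   integrating p^2 p'''' + p'' = 0 over the curve yields that the integral of p p''^2 is 0, so p
   and kappa are constant and the curve is an ellipse. Conversely ellipses have constant curvature, and
   then the first variation of the integrand is an exact derivative.

   The test functions f range over an algebra A generated by p and the components of the derivatives
   of the curve. It is closed under differentiation and contains the left side of the
   Euler-Lagrange equation, so no bump functions are needed. *)
theory Submission
  imports Defs
begin

section \<open>Equi-affine curvature in an arbitrary parametrisation\<close>

text \<open>The left side of the Euler-Lagrange equation factors as (D^2 + \<kappa>) D^2 p, and D^2
  + \<kappa> annihilates the components of T because T'' = - \<kappa> T. This is why each right side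
  g is sought in the form h'' + \<kappa> h. The two directions need different variations. For a
  critical point the fields f N give enough information. For an ellipse every smooth variation has
  to be handled, possibly tangential and nonlinear in the parameter e. The first variation is
  therefore computed for an arbitrary smooth family and specialised afterwards. As curvature
  involves four derivatives along the curve, it is first made explicit in the jet, then
  differentiated in e under the integral, and the derivatives in e and t are interchanged.\<close>

lemma bounded_bilinear_area_form: "bounded_bilinear area_form"
proof
  show "\<exists>K. \<forall>a b. norm (area_form a b) \<le> norm a * norm b * K"
  proof (intro exI allI)
    fix a b :: "real \<times> real"
    have "\<bar>fst a\<bar> * \<bar>snd b\<bar> \<le> norm a * norm b" "\<bar>snd a\<bar> * \<bar>fst b\<bar> \<le> norm a * norm b"
      using norm_fst_le[of "fst a" "snd a"] norm_snd_le[of "snd a" "fst a"]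
        norm_fst_le[of "fst b" "snd b"] norm_snd_le[of "snd b" "fst b"]
      by (auto intro!: mult_mono)
    then have "\<bar>fst a * snd b - snd a * fst b\<bar> \<le> norm a * norm b + norm a * norm b"
      by (intro order_trans[OF abs_triangle_ineq4] add_mono) (auto simp: abs_mult)
    then show "norm (area_form a b) \<le> norm a * norm b * 2"
      by (simp add: area_form_def)
  qed
qed (simp_all add: area_form_def algebra_simps)

lemmas area_form_simps =
  bounded_bilinear.add_left[OF bounded_bilinear_area_form]
  bounded_bilinear.add_right[OF bounded_bilinear_area_form]
  bounded_bilinear.diff_left[OF bounded_bilinear_area_form]
  bounded_bilinear.diff_right[OF bounded_bilinear_area_form]
  bounded_bilinear.minus_left[OF bounded_bilinear_area_form]
  bounded_bilinear.minus_right[OF bounded_bilinear_area_form]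
  bounded_bilinear.scaleR_left[OF bounded_bilinear_area_form]
  bounded_bilinear.scaleR_right[OF bounded_bilinear_area_form]
  bounded_bilinear.zero_left[OF bounded_bilinear_area_form]
  bounded_bilinear.zero_right[OF bounded_bilinear_area_form]

lemma area_form_self [simp]: "area_form u u = 0"
  by (simp add: area_form_def)

lemma area_form_swap: "area_form v u = - area_form u v"
  by (simp add: area_form_def)

lemma has_real_derivative_area_form [derivative_intros]:
  assumes "(u has_vector_derivative u') (at t within S)" "(v has_vector_derivative v') (at t within S)"
  shows "((\<lambda>t. area_form (u t) (v t)) has_real_derivative
          area_form (u t) v' + area_form u' (v t)) (at t within S)"
  using bounded_bilinear.has_vector_derivative[OF bounded_bilinear_area_form assms]
  by (simp add: has_real_derivative_iff_has_vector_derivative)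

lemma continuous_on_area_form [continuous_intros]:
  "continuous_on S u \<Longrightarrow> continuous_on S v \<Longrightarrow> continuous_on S (\<lambda>x. area_form (u x) (v x))"
  by (rule bounded_bilinear.continuous_on[OF bounded_bilinear_area_form])

lemma vd_eqI: "(\<And>t. (c has_vector_derivative c1 t) (at t)) \<Longrightarrow> vd c = c1"
  by (auto simp: vd_def intro!: ext vector_derivative_at)

text \<open>The equi-affine curvature in an arbitrary parameter as a function of the first four
  derivatives. The nested \<open>Ds\<close> operators hide this dependence; an explicit expression
  can be differentiated along a variation.\<close>

definition jet_curv :: "real \<times> real \<Rightarrow> real \<times> real \<Rightarrow> real \<times> real \<Rightarrow> real \<times> real \<Rightarrow> real" where
  "jet_curv u1 u2 u3 u4 =
     area_form u1 u2 powr (-5/3) * (4/3 * area_form u2 u3 + area_form u1 u4 / 3)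
     - 5/9 * area_form u1 u2 powr (-8/3) * (area_form u1 u3)\<^sup>2"

lemma aff_curv_eq_jet_curv:
  assumes c: "\<And>t. (c has_vector_derivative c1 t) (at t)"
    and c1: "\<And>t. (c1 has_vector_derivative c2 t) (at t)"
    and c2: "\<And>t. (c2 has_vector_derivative c3 t) (at t)"
    and c3: "\<And>t. (c3 has_vector_derivative c4 t) (at t)"
    and pos: "\<And>t. area_form (c1 t) (c2 t) > 0"
  shows "aff_curv c t = jet_curv (c1 t) (c2 t) (c3 t) (c4 t)"
proof -
  define w where "w t = area_form (c1 t) (c2 t)" for t
  define q where "q t = area_form (c1 t) (c3 t)" for t
  define r where "r t = w t powr (-1/3)" for t
  have w: "w t > 0" for t
    using pos by (simp add: w_def)
  have rpos: "r t > 0" for t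
    using w[of t] by (simp add: r_def)
  have rpow: "r t ^ n = w t powr (- real n / 3)" if "n > 0" for n t
    using that w[of t] by (simp add: r_def powr_power)
  have dw: "(w has_real_derivative q t) (at t)" for t
    unfolding w_def[abs_def] q_def by (rule derivative_eq_intros c1 c2 refl)+ simp
  have dq: "(q has_real_derivative area_form (c2 t) (c3 t) + area_form (c1 t) (c4 t)) (at t)" for t
    unfolding q_def[abs_def] by (rule derivative_eq_intros c1 c3 refl)+ simp
  define r1 where "r1 t = - (1/3) * r t ^ 4 * q t" for t
  define r2 where "r2 t = 4/9 * r t ^ 7 * (q t)\<^sup>2
     - 1/3 * r t ^ 4 * (area_form (c2 t) (c3 t) + area_form (c1 t) (c4 t))" for t
  have dr: "(r has_real_derivative r1 t) (at t)" for t
  proof -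
    have "((\<lambda>t. w t powr (-1/3)) has_real_derivative (-1/3) * w t powr (-1/3 - 1) * q t) (at t)"
      using DERIV_fun_powr[OF dw w, of "-1/3"] by simp
    moreover have "w t powr (-1/3 - 1) = r t ^ 4"
      by (simp add: rpow)
    ultimately show ?thesis
      by (simp add: r_def[abs_def] r1_def)
  qed
  have dr1: "(r1 has_real_derivative r2 t) (at t)" for t
    unfolding r1_def[abs_def]
    by (rule derivative_eq_intros dr dq refl)+ (simp add: r1_def r2_def field_simps power2_eq_square eval_nat_numeral)
  \<comment> \<open>Replacing every power of \<open>w\<close> by a power of \<open>r\<close>, which
    is dt/ds, turns the final comparison into a rational identity.\<close>
  have wr: "w t = 1 / r t ^ 3" for t
  proof -
    have "w t * r t ^ 3 = 1"
      using w[of t] rpow[of 3 t] by (simp add: powr_minus field_simps)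
    then show ?thesis
      using rpos[of t] by (simp add: field_simps)
  qed
  have vdc: "vd c = c1" "vd c1 = c2"
    by (intro vd_eqI c c1)+
  have ds: "Ds c f t = r t *\<^sub>R vd f t" for f t
    using w[of t] by (simp add: Ds_def affine_speed_def vdc w_def[symmetric] r_def powr_minus_divide)
  have T: "aff_T c = (\<lambda>t. r t *\<^sub>R c1 t)"
    by (auto simp: aff_T_def ds vdc)
  have "vd (aff_T c) = (\<lambda>t. r t *\<^sub>R c2 t + r1 t *\<^sub>R c1 t)"
    unfolding T by (intro vd_eqI) (rule derivative_eq_intros dr c1 refl)+
  then have N: "aff_N c = (\<lambda>t. (r t * r1 t) *\<^sub>R c1 t + (r t)\<^sup>2 *\<^sub>R c2 t)"
    by (auto simp: aff_N_def ds power2_eq_square algebra_simps)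
  have N1: "vd (aff_N c) = (\<lambda>t. (r1 t * r1 t + r t * r2 t) *\<^sub>R c1 t + (r t * r1 t) *\<^sub>R c2 t
      + (2 * r t * r1 t) *\<^sub>R c2 t + (r t)\<^sup>2 *\<^sub>R c3 t)"
    unfolding N by (intro vd_eqI) (rule derivative_eq_intros dr dr1 c1 c2 refl | simp add: algebra_simps)+
  have "aff_curv c t = r t * ((r t * r1 t)\<^sup>2 * w t + r t * r1 t * (2 * r t * r1 t) * w t
      + r t * r1 t * (r t)\<^sup>2 * q t - (r t)\<^sup>2 * (r1 t * r1 t + r t * r2 t) * w t
      + (r t)\<^sup>2 * (r t)\<^sup>2 * area_form (c2 t) (c3 t))"
    unfolding aff_curv_def ds N1
    by (simp add: N area_form_simps w_def q_def area_form_swap[of "c2 t" "c1 t"] power2_eq_square algebra_simps)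
  also have "\<dots> = r t ^ 5 * (4/3 * area_form (c2 t) (c3 t) + area_form (c1 t) (c4 t) / 3)
     - 5/9 * r t ^ 8 * (q t)\<^sup>2"
    using rpos[of t] unfolding wr r1_def r2_def
    by (simp add: field_simps) (simp add: power2_eq_square eval_nat_numeral algebra_simps)?
  also have "\<dots> = jet_curv (c1 t) (c2 t) (c3 t) (c4 t)"
    by (simp add: rpow jet_curv_def w_def q_def)
  finally show ?thesis .
qed

section \<open>Smooth maps of two real variables\<close>

definition P1 :: "(real \<times> real \<Rightarrow> real \<times> real) \<Rightarrow> real \<times> real \<Rightarrow> real \<times> real" where
  "P1 F p = vector_derivative (\<lambda>u. F (u, snd p)) (at (fst p))"

definition P2 :: "(real \<times> real \<Rightarrow> real \<times> real) \<Rightarrow> real \<times> real \<Rightarrow> real \<times> real" where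
  "P2 F p = vector_derivative (\<lambda>v. F (fst p, v)) (at (snd p))"

text \<open>\<open>Ck2\<close> only asserts that some partial derivatives exist. Uniqueness
  identifies the witnesses with \<open>P1\<close> and \<open>P2\<close>, so that smoothness can be
  iterated on named functions.\<close>

lemma Ck2_SucD:
  assumes "Ck2 (Suc k) F"
  shows "((\<lambda>u. F (u, t)) has_vector_derivative P1 F (e, t)) (at e)"
    and "((\<lambda>v. F (e, v)) has_vector_derivative P2 F (e, t)) (at t)"
    and "Ck2 k (P1 F)" and "Ck2 k (P2 F)"
proof -
  obtain D1 D2 where D1: "\<And>p. ((\<lambda>u. F (u, snd p)) has_vector_derivative D1 p) (at (fst p))"
      and D2: "\<And>p. ((\<lambda>v. F (fst p, v)) has_vector_derivative D2 p) (at (snd p))"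
      and Ck: "Ck2 k D1" "Ck2 k D2"
    using assms unfolding Ck2.simps by metis
  have P1: "P1 F = D1"
    unfolding P1_def using D1 by (intro ext vector_derivative_at)
  have P2: "P2 F = D2"
    unfolding P2_def using D2 by (intro ext vector_derivative_at)
  show "((\<lambda>u. F (u, t)) has_vector_derivative P1 F (e, t)) (at e)"
    using D1[of "(e, t)"] by (simp add: P1)
  show "((\<lambda>v. F (e, v)) has_vector_derivative P2 F (e, t)) (at t)"
    using D2[of "(e, t)"] by (simp add: P2)
  show "Ck2 k (P1 F)" "Ck2 k (P2 F)"
    using Ck by (simp_all add: P1 P2)
qed

lemma smooth2D: "smooth2 F \<Longrightarrow> Ck2 k F"
  by (simp add: smooth2_def)

lemma smooth2_has_P1: "smooth2 F \<Longrightarrow> ((\<lambda>u. F (u, t)) has_vector_derivative P1 F (e, t)) (at e)"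
  by (rule Ck2_SucD(1)[OF smooth2D])

lemma smooth2_has_P2: "smooth2 F \<Longrightarrow> ((\<lambda>v. F (e, v)) has_vector_derivative P2 F (e, t)) (at t)"
  by (rule Ck2_SucD(2)[OF smooth2D])

lemma smooth2_P1: "smooth2 F \<Longrightarrow> smooth2 (P1 F)"
  unfolding smooth2_def[of "P1 F"] by (rule allI, rule Ck2_SucD(3)[OF smooth2D])

lemma smooth2_P2: "smooth2 F \<Longrightarrow> smooth2 (P2 F)"
  unfolding smooth2_def[of "P2 F"] by (rule allI, rule Ck2_SucD(4)[OF smooth2D])

lemma smooth2_continuous: "smooth2 F \<Longrightarrow> continuous_on S F"
  using smooth2D[of F 0] by (auto intro: continuous_on_subset)

lemma smooth2_continuous_section: "smooth2 F \<Longrightarrow> continuous_on S (\<lambda>t. F (e, t))"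
  by (rule continuous_on_compose2[OF smooth2_continuous[of F UNIV]]) (auto intro!: continuous_intros)

text \<open>Write \<open>F\<close> as an integral of \<open>P2 F\<close> in the second variable,
  differentiate under the integral in the first, and apply the fundamental theorem of calculus to
  the result.\<close>

lemma P2_P1_commute:
  assumes F: "smooth2 F"
  shows "P2 (P1 F) = P1 (P2 F)"
proof
  fix p :: "real \<times> real"
  obtain e t where p: "p = (e, t)" by force
  \<comment> \<open>\<open>t\<close> is interior to this interval, so the derivative found within it
    is a full derivative.\<close>
  let ?a = "t - 1" and ?b = "t + 1"
  let ?G = "P1 (P2 F)"
  note smooth = F smooth2_P1[OF F] smooth2_P2[OF F] smooth2_P1[OF smooth2_P2[OF F]]
  have contG: "continuous_on S ?G" for S
    by (intro smooth2_continuous smooth)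
  have ftc: "F (u, v) = F (u, ?a) + integral {?a..v} (\<lambda>\<tau>. P2 F (u, \<tau>))" if "?a \<le> v" for u v
  proof -
    have "((\<lambda>\<tau>. P2 F (u, \<tau>)) has_integral F (u, v) - F (u, ?a)) {?a..v}"
      using that
      by (rule fundamental_theorem_of_calculus) (rule has_vector_derivative_at_within[OF smooth2_has_P2[OF F]])
    then show ?thesis
      by (simp add: integral_unique)
  qed
  have P1_eq: "P1 F (e, v) = P1 F (e, ?a) + integral {?a..v} (\<lambda>\<tau>. ?G (e, \<tau>))" if "?a \<le> v" for v
  proof -
    have "((\<lambda>u. integral (cbox ?a v) (\<lambda>\<tau>. P2 F (u, \<tau>))) has_vector_derivative
        integral (cbox ?a v) (\<lambda>\<tau>. ?G (e, \<tau>))) (at e within UNIV)"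
    proof (rule leibniz_rule_vector_derivative)
      show "((\<lambda>u. P2 F (u, \<tau>)) has_vector_derivative ?G (u, \<tau>)) (at u within UNIV)" for u \<tau>
        using smooth by (simp add: smooth2_has_P1)
      show "(\<lambda>\<tau>. P2 F (u, \<tau>)) integrable_on cbox ?a v" for u
        by (intro integrable_continuous smooth2_continuous_section smooth)
      show "continuous_on (UNIV \<times> cbox ?a v) (\<lambda>(u, \<tau>). ?G (u, \<tau>))"
        using contG by simp
    qed auto
    then have "((\<lambda>u. F (u, ?a) + integral {?a..v} (\<lambda>\<tau>. P2 F (u, \<tau>))) has_vector_derivative
        P1 F (e, ?a) + integral {?a..v} (\<lambda>\<tau>. ?G (e, \<tau>))) (at e)"
      by (intro has_vector_derivative_add smooth2_has_P1 F) (simp add: cbox_interval)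
    then have "((\<lambda>u. F (u, v)) has_vector_derivative
        P1 F (e, ?a) + integral {?a..v} (\<lambda>\<tau>. ?G (e, \<tau>))) (at e)"
      by (simp add: ftc[OF that, symmetric])
    with smooth2_has_P1[OF F, of v e] show ?thesis
      by (rule vector_derivative_unique_at)
  qed
  have "((\<lambda>v. integral {?a..v} (\<lambda>\<tau>. ?G (e, \<tau>))) has_vector_derivative ?G (e, t)) (at t within {?a..?b})"
    by (rule integral_has_vector_derivative) (auto intro: smooth2_continuous_section smooth)
  from has_vector_derivative_add[OF has_vector_derivative_const this, of "P1 F (e, ?a)"]
  have "((\<lambda>v. P1 F (e, ?a) + integral {?a..v} (\<lambda>\<tau>. ?G (e, \<tau>))) has_vector_derivative ?G (e, t)) (at t within {?a..?b})"
    by simp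
  then have "((\<lambda>v. P1 F (e, v)) has_vector_derivative ?G (e, t)) (at t within {?a..?b})"
    by (rule has_vector_derivative_transform[rotated 2]) (simp, rule P1_eq, simp)
  then have "((\<lambda>v. P1 F (e, v)) has_vector_derivative ?G (e, t)) (at t)"
    by (subst (asm) at_within_interior) auto
  then show "P2 (P1 F) p = P1 (P2 F) p"
    unfolding p by (rule vector_derivative_unique_at[OF smooth2_has_P2[OF smooth(2)]])
qed

lemma smooth2_P2_funpow: "smooth2 F \<Longrightarrow> smooth2 ((P2 ^^ i) F)"
  by (induction i) (auto intro: smooth2_P2)

lemma P2_funpow_P1: "smooth2 F \<Longrightarrow> (P2 ^^ i) (P1 F) = P1 ((P2 ^^ i) F)"
  by (induction i) (auto simp: P2_P1_commute smooth2_P2_funpow)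

lemma vd_section: "smooth2 F \<Longrightarrow> vd (\<lambda>t. F (e, t)) = (\<lambda>t. P2 F (e, t))"
  by (rule vd_eqI) (rule smooth2_has_P2)

lemma vd_funpow_section: "smooth2 F \<Longrightarrow> (vd ^^ i) (\<lambda>t. F (e, t)) = (\<lambda>t. (P2 ^^ i) F (e, t))"
  by (induction i) (auto simp: vd_section smooth2_P2_funpow)

section \<open>First variation of curvature integrals\<close>

definition djet_curv ::
  "real \<times> real \<Rightarrow> real \<times> real \<Rightarrow> real \<times> real \<Rightarrow> real \<times> real \<Rightarrow>
   real \<times> real \<Rightarrow> real \<times> real \<Rightarrow> real \<times> real \<Rightarrow> real \<times> real \<Rightarrow> real" where
  "djet_curv u1 u2 u3 u4 v1 v2 v3 v4 =
     (let w = area_form u1 u2; dw = area_form u1 v2 + area_form v1 u2;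
          q = area_form u1 u3; dq = area_form u1 v3 + area_form v1 u3
      in (-5/3) * w powr (-8/3) * dw * (4/3 * area_form u2 u3 + area_form u1 u4 / 3)
         + w powr (-5/3) * (4/3 * (area_form u2 v3 + area_form v2 u3) + (area_form u1 v4 + area_form v1 u4) / 3)
         - 5/9 * ((-8/3) * w powr (-11/3) * dw * q\<^sup>2 + w powr (-8/3) * (2 * q * dq)))"

lemma has_real_derivative_jet_curv:
  assumes u: "(u1 has_vector_derivative v1) (at x within S)" "(u2 has_vector_derivative v2) (at x within S)"
      "(u3 has_vector_derivative v3) (at x within S)" "(u4 has_vector_derivative v4) (at x within S)"
    and pos: "area_form (u1 x) (u2 x) > 0"
  shows "((\<lambda>x. jet_curv (u1 x) (u2 x) (u3 x) (u4 x)) has_real_derivative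
           djet_curv (u1 x) (u2 x) (u3 x) (u4 x) v1 v2 v3 v4) (at x within S)"
  unfolding jet_curv_def
  apply (rule derivative_eq_intros u refl pos numeral_neq_zero)+
  using pos
  by (simp add: djet_curv_def Let_def powr_diff[symmetric] field_simps power2_eq_square)

lemma continuous_on_jet_curv:
  assumes "continuous_on S u1" "continuous_on S u2" "continuous_on S u3" "continuous_on S u4"
    and "\<And>x. x \<in> S \<Longrightarrow> area_form (u1 x) (u2 x) > 0"
  shows "continuous_on S (\<lambda>x. jet_curv (u1 x) (u2 x) (u3 x) (u4 x))"
  unfolding jet_curv_def using assms by (intro continuous_intros) (auto simp: less_imp_neq[symmetric])

lemma continuous_on_djet_curv:
  assumes "continuous_on S u1" "continuous_on S u2" "continuous_on S u3" "continuous_on S u4"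
    and "continuous_on S v1" "continuous_on S v2" "continuous_on S v3" "continuous_on S v4"
    and "\<And>x. x \<in> S \<Longrightarrow> area_form (u1 x) (u2 x) > 0"
  shows "continuous_on S (\<lambda>x. djet_curv (u1 x) (u2 x) (u3 x) (u4 x) (v1 x) (v2 x) (v3 x) (v4 x))"
  unfolding djet_curv_def Let_def using assms by (intro continuous_intros) (auto simp: less_imp_neq[symmetric])

lemma section_curvature:
  assumes F: "smooth2 F"
  shows "affine_speed (\<lambda>t. F (e, t)) t = area_form (P2 F (e, t)) ((P2 ^^ 2) F (e, t))"
    and "(\<And>t. affine_speed (\<lambda>t. F (e, t)) t > 0) \<Longrightarrow> aff_curv (\<lambda>t. F (e, t)) t =
      jet_curv (P2 F (e, t)) ((P2 ^^ 2) F (e, t)) ((P2 ^^ 3) F (e, t)) ((P2 ^^ 4) F (e, t))"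
proof -
  show speed: "affine_speed (\<lambda>t. F (e, t)) t = area_form (P2 F (e, t)) ((P2 ^^ 2) F (e, t))" for t
    by (simp add: affine_speed_def vd_section F smooth2_P2 eval_nat_numeral)
  have deriv: "((\<lambda>t. (P2 ^^ i) F (e, t)) has_vector_derivative (P2 ^^ Suc i) F (e, t)) (at t)" for i t
    using smooth2_has_P2[OF smooth2_P2_funpow[OF F]] by simp
  assume "\<And>t. affine_speed (\<lambda>t. F (e, t)) t > 0"
  then show "aff_curv (\<lambda>t. F (e, t)) t =
      jet_curv (P2 F (e, t)) ((P2 ^^ 2) F (e, t)) ((P2 ^^ 3) F (e, t)) ((P2 ^^ 4) F (e, t))"
    using deriv[of 0] deriv[of 1] deriv[of 2] deriv[of 3]
    by (intro aff_curv_eq_jet_curv) (simp_all add: speed eval_nat_numeral)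
qed

text \<open>With \<open>\<psi>\<close> equal to \<open>sqrt\<close>, to 1 and to the identity, one
  variational formula serves three of the four functionals.\<close>

definition curv_integral :: "(real \<Rightarrow> real) \<Rightarrow> real \<Rightarrow> (real \<Rightarrow> real \<times> real) \<Rightarrow> real" where
  "curv_integral \<psi> L c = integral {0..L} (\<lambda>t. \<psi> (aff_curv c t) * affine_speed c t powr (1/3))"

text \<open>The parameter need be equi-affine only at \<open>e = 0\<close>. There every power of
  \<open>w\<close> is 1 and |c', c'''| vanishes, which reduces \<open>djet_curv\<close> to the
  displayed linear expression; \<open>dw / 3\<close> is the variation of the length element.\<close>

theorem first_variation_curv_integral:
  fixes F :: "real \<times> real \<Rightarrow> real \<times> real"
  defines "c \<equiv> \<lambda>i t. (P2 ^^ i) F (0, t)" and "V \<equiv> \<lambda>i t. P1 ((P2 ^^ i) F) (0, t)"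
  assumes F: "smooth2 F"
    and \<delta>: "\<delta> > 0" "\<And>e. \<bar>e\<bar> < \<delta> \<Longrightarrow> strictly_pos_curved (\<lambda>t. F (e, t))"
    and unit: "\<And>t. affine_speed (c 0) t = 1"
    and \<psi>: "\<And>x. x > 0 \<Longrightarrow> (\<psi> has_real_derivative \<psi>' x) (at x)" "continuous_on {0<..} \<psi>'"
  defines "dw \<equiv> \<lambda>t. area_form (c 1 t) (V 2 t) + area_form (V 1 t) (c 2 t)"
  shows "((\<lambda>e. curv_integral \<psi> L (\<lambda>t. F (e, t))) has_real_derivative
     integral {0..L} (\<lambda>t. \<psi>' (aff_curv (c 0) t) *
        (-5/3 * aff_curv (c 0) t * dw t
          + 4/3 * (area_form (c 2 t) (V 3 t) + area_form (V 2 t) (c 3 t))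
          + (area_form (c 1 t) (V 4 t) + area_form (V 1 t) (c 4 t)) / 3)
        + \<psi> (aff_curv (c 0) t) * dw t / 3)) (at 0)"
proof -
  define f where "f i = (P2 ^^ i) F" for i
  define g where "g i = P1 (f i)" for i
  \<comment> \<open>Positivity is known only for small \<open>e\<close>, so differentiation under
    the integral takes place on this open interval.\<close>
  define U where "U = {-\<delta><..<\<delta>}"
  have smooth: "smooth2 (f i)" "smooth2 (g i)" for i
    by (auto simp: f_def g_def intro: smooth2_P2_funpow smooth2_P1 F)
  have cont: "continuous_on S (f i)" "continuous_on S (g i)" for S i
    by (auto intro: smooth2_continuous smooth)
  define w where "w p = area_form (f 1 p) (f 2 p)" for p
  define K where "K p = jet_curv (f 1 p) (f 2 p) (f 3 p) (f 4 p)" for p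
  define w' where "w' p = area_form (f 1 p) (g 2 p) + area_form (g 1 p) (f 2 p)" for p
  define K' where "K' p = djet_curv (f 1 p) (f 2 p) (f 3 p) (f 4 p) (g 1 p) (g 2 p) (g 3 p) (g 4 p)" for p
  have speed: "affine_speed (\<lambda>t. F (e, t)) t = w (e, t)" for e t
    by (simp add: section_curvature[OF F] w_def f_def)
  have wpos: "w (e, t) > 0" if "e \<in> U" for e t
    using \<delta>(2)[of e] that by (auto simp: strictly_pos_curved_def speed U_def)
  have wnz: "\<forall>p\<in>U \<times> S. w p \<noteq> 0" for S
    using wpos by (auto simp: less_imp_neq[symmetric])
  have curv: "aff_curv (\<lambda>t. F (e, t)) t = K (e, t)" if "e \<in> U" for e t
    using wpos[OF that] by (simp add: section_curvature(2)[OF F] speed K_def f_def)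
  have Kpos: "K (e, t) > 0" if "e \<in> U" for e t
    using \<delta>(2)[of e] that by (auto simp: strictly_pos_curved_def U_def curv)
  have contw: "continuous_on S w" "continuous_on S w'" for S
    unfolding w_def w'_def by (intro continuous_intros cont)+
  have contK: "continuous_on (U \<times> S) K" "continuous_on (U \<times> S) K'" for S
    unfolding K_def K'_def using wpos
    by (intro continuous_on_jet_curv continuous_on_djet_curv cont; force simp: w_def)+
  have cont_comp: "continuous_on (U \<times> S) (\<lambda>p. h (K p))" if "continuous_on {0<..} h" for h S
    using that by (rule continuous_on_compose2[OF _ contK(1)]) (auto simp: Kpos)
  have cont_\<psi>: "continuous_on {0<..} \<psi>"
    using \<psi>(1) by (intro continuous_at_imp_continuous_on) (auto intro: DERIV_isCont)
  have dw: "((\<lambda>e. w (e, t)) has_real_derivative w' (e, t)) (at e)" for e t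
    unfolding w_def w'_def g_def
    by (rule has_real_derivative_area_form[OF smooth2_has_P1 smooth2_has_P1]) (rule smooth)+
  have dK: "((\<lambda>e. K (e, t)) has_real_derivative K' (e, t)) (at e)" if "e \<in> U" for e t
    unfolding K_def K'_def g_def using wpos[OF that, of t]
    by (intro has_real_derivative_jet_curv smooth2_has_P1 smooth) (simp add: w_def)
  define I where "I e t = \<psi> (K (e, t)) * w (e, t) powr (1/3)" for e t
  define I' where "I' e t = \<psi>' (K (e, t)) * K' (e, t) * w (e, t) powr (1/3)
      + \<psi> (K (e, t)) * (1/3 * w (e, t) powr (1/3 - 1) * w' (e, t))" for e t
  have dI: "((\<lambda>e. I e t) has_real_derivative I' e t) (at e)" if "e \<in> U" for e t
    unfolding I_def I'_def
    using DERIV_mult[OF DERIV_chain2[OF \<psi>(1)[OF Kpos[OF that]] dK[OF that]]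
        DERIV_fun_powr[OF dw wpos[OF that], of t "1/3"]]
    by (simp add: algebra_simps)
  have contI: "continuous_on (U \<times> S) (\<lambda>(e, t). I e t)" "continuous_on (U \<times> S) (\<lambda>(e, t). I' e t)" for S
  proof -
    have "continuous_on (U \<times> S) (\<lambda>p. \<psi> (K p) * w p powr (1/3))"
      by (intro continuous_intros cont_comp cont_\<psi> contw) (rule wnz)
    then show "continuous_on (U \<times> S) (\<lambda>(e, t). I e t)"
      by (simp add: I_def case_prod_unfold)
    have "continuous_on (U \<times> S) (\<lambda>p. \<psi>' (K p) * K' p * w p powr (1/3)
        + \<psi> (K p) * (1/3 * w p powr (1/3 - 1) * w' p))"
      by (intro continuous_intros cont_comp cont_\<psi> \<psi>(2) contw contK) (rule wnz)+
    then show "continuous_on (U \<times> S) (\<lambda>(e, t). I' e t)"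
      by (simp add: I'_def case_prod_unfold)
  qed
  have "0 \<in> U" "convex U" "open U"
    using \<delta>(1) by (auto simp: U_def)
  have "((\<lambda>e. integral (cbox 0 L) (I e)) has_real_derivative integral (cbox 0 L) (I' 0)) (at 0 within U)"
  proof (rule leibniz_rule_field_derivative)
    show "((\<lambda>e. I e t) has_real_derivative I' e t) (at e within U)" if "e \<in> U" for e t
      using dI[OF that] by (rule has_field_derivative_at_within)
    show "I e integrable_on cbox 0 L" if "e \<in> U" for e
    proof (rule integrable_continuous)
      show "continuous_on (cbox 0 L) (I e)"
      proof -
        have "continuous_on (cbox 0 L) (Pair e)" "Pair e ` cbox 0 L \<subseteq> U \<times> UNIV"
          using that by (auto intro!: continuous_intros)
        from continuous_on_compose2[OF contI(1) this] show ?thesis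
          by simp
      qed
    qed
    show "continuous_on (U \<times> cbox 0 L) (\<lambda>(x, t). I' x t)"
      by (rule contI)
  qed fact+
  then have "((\<lambda>e. integral {0..L} (I e)) has_real_derivative integral {0..L} (I' 0)) (at 0)"
    unfolding at_within_open[OF \<open>0 \<in> U\<close> \<open>open U\<close>] box_real .
  then have deriv: "((\<lambda>e. curv_integral \<psi> L (\<lambda>t. F (e, t))) has_real_derivative integral {0..L} (I' 0)) (at 0)"
    using \<open>open U\<close> \<open>0 \<in> U\<close>
  proof (rule has_field_derivative_transform_within_open)
    fix e assume "e \<in> U"
    then have "I e = (\<lambda>t. \<psi> (aff_curv (\<lambda>t. F (e, t)) t) * affine_speed (\<lambda>t. F (e, t)) t powr (1/3))"
      unfolding I_def speed by (simp only: curv)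
    then show "integral {0..L} (I e) = curv_integral \<psi> L (\<lambda>t. F (e, t))"
      unfolding curv_integral_def by (rule arg_cong)
  qed
  have I'0: "I' 0 t = \<psi>' (aff_curv (c 0) t) *
        (-5/3 * aff_curv (c 0) t * dw t
          + 4/3 * (area_form (c 2 t) (V 3 t) + area_form (V 2 t) (c 3 t))
          + (area_form (c 1 t) (V 4 t) + area_form (V 1 t) (c 4 t)) / 3)
        + \<psi> (aff_curv (c 0) t) * dw t / 3" for t
  proof -
    have w1: "w (0, t) = 1" for t
      using unit[of t] by (simp add: c_def speed)
    \<comment> \<open>\<open>w\<close> is constantly 1 along the original curve, so its derivative
      |c', c'''| is zero and the quadratic term of the curvature drops out to first order.\<close>
    have "((\<lambda>s. w (0, s)) has_real_derivative area_form (f 1 (0, t)) (f 3 (0, t)) + area_form (f 2 (0, t)) (f 2 (0, t))) (at t)"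
      unfolding w_def
      using smooth2_has_P2[OF smooth(1)[of 1]] smooth2_has_P2[OF smooth(1)[of 2]]
      by (intro has_real_derivative_area_form) (simp_all add: f_def eval_nat_numeral)
    then have "((\<lambda>s. 1) has_real_derivative area_form (f 1 (0, t)) (f 3 (0, t))) (at t)"
      by (simp add: w1)
    then have q: "area_form (f 1 (0, t)) (f 3 (0, t)) = 0"
      by (rule DERIV_unique) (rule DERIV_const)
    have k: "aff_curv (c 0) t = K (0, t)"
      using curv[OF \<open>0 \<in> U\<close>] by (simp add: c_def)
    have area1: "area_form (f 1 (0, t)) (f 2 (0, t)) = 1"
      using w1[of t] by (simp add: w_def)
    have "K' (0, t) = -5/3 * K (0, t) * dw t
          + 4/3 * (area_form (c 2 t) (V 3 t) + area_form (V 2 t) (c 3 t))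
          + (area_form (c 1 t) (V 4 t) + area_form (V 1 t) (c 4 t)) / 3"
      using area1 q
      by (simp add: K'_def K_def djet_curv_def jet_curv_def Let_def dw_def c_def V_def f_def g_def algebra_simps add_divide_distrib)
    moreover have "w' (0, t) = dw t"
      by (simp add: w'_def dw_def c_def V_def f_def g_def)
    ultimately show ?thesis
      by (simp add: I'_def k w1)
  qed
  show ?thesis
    using deriv by (simp add: I'0[abs_def])
qed

section \<open>Unit speed curves and their smooth functions\<close>

lemma periodic_int_shift:
  fixes h :: "real \<Rightarrow> 'a"
  assumes "\<And>t. h (t + L) = h t"
  shows "h (t + of_int n * L) = h t"
proof -
  have nat: "h (t + real m * L) = h t" for m t
  proof (induction m)
    case (Suc m)
    then show ?case
      using assms[of "t + real m * L"] by (simp add: algebra_simps)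
  qed simp
  show ?thesis
  proof (cases "n \<ge> 0")
    case True
    then show ?thesis
      using nat[of t "nat n"] by simp
  next
    case False
    then show ?thesis
      using nat[of "t + of_int n * L" "nat (- n)"] by simp
  qed
qed

text \<open>A single \<open>s\<close> represents \<open>t\<close> modulo \<open>L\<close> for all
  periodic functions into the given type, so several conditions can be transferred at the same
  point.\<close>

lemma periodic_representative:
  fixes L :: real
  assumes "L > 0"
  obtains s where "a \<le> s" "s < a + L" "\<And>h :: real \<Rightarrow> 'a. (\<And>t. h (t + L) = h t) \<Longrightarrow> h t = h s"
proof
  let ?n = "\<lfloor>(t - a) / L\<rfloor>"
  have "of_int ?n \<le> (t - a) / L" "(t - a) / L < of_int ?n + 1"
    by linarith+
  then have "of_int ?n * L \<le> t - a" "t - a < (of_int ?n + 1) * L"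
    by (simp_all only: pos_le_divide_eq[OF assms] pos_divide_less_eq[OF assms])
  then show "a \<le> t + of_int (- ?n) * L" "t + of_int (- ?n) * L < a + L"
    by (simp_all add: algebra_simps)
  show "h t = h (t + of_int (- ?n) * L)" if "\<And>t. h (t + L) = h t" for h :: "real \<Rightarrow> 'a"
    using periodic_int_shift[of h L t "- ?n", OF that] by simp
qed

lemma periodic_derivative:
  assumes f: "\<And>t. (f has_vector_derivative f' t) (at t)" and "\<And>t. f (t + L) = f t"
  shows "f' (t + L) = f' t"
proof -
  have "((\<lambda>t. t + L) has_vector_derivative 1) (at t)"
    by (auto intro!: derivative_eq_intros)
  from vector_diff_chain_at[OF this f]
  have "(f has_vector_derivative f' (t + L)) (at t)"
    by (simp add: o_def assms(2))
  then show ?thesis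
    using f by (rule vector_derivative_unique_at)
qed

lemma smooth_curve_has_vd:
  "smooth_curve c \<Longrightarrow> ((vd ^^ i) c has_vector_derivative (vd ^^ Suc i) c t) (at t)"
  by (simp add: smooth_curve_def vd_def vector_derivative_works)

lemma area_form_basis: "area_form u v = 1 \<Longrightarrow> x = area_form x v *\<^sub>R u + area_form u x *\<^sub>R v"
  by (rule prod_eqI; simp add: area_form_def; algebra)

lemma P2_funpow_periodic:
  assumes F: "smooth2 F" and per: "\<And>e t. F (e, t + L) = F (e, t)"
  shows "(P2 ^^ i) F (e, t + L) = (P2 ^^ i) F (e, t)"
proof (induction i arbitrary: t)
  case (Suc i)
  from periodic_derivative[OF smooth2_has_P2[OF smooth2_P2_funpow[OF F, of i], of e] Suc]
  show ?case
    by simp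
qed (simp add: per)

text \<open>Both positivity conditions are open in \<open>(e, t)\<close> and hold on the compact set
  \<open>{0} \<times> {0..L}\<close>, hence on a uniform neighbourhood of it. Periodicity carries
  them to all \<open>t\<close>.\<close>

lemma smooth2_section_positive:
  assumes "L > 0" and F: "smooth2 F" and per: "\<And>e t. F (e, t + L) = F (e, t)"
    and pos: "strictly_pos_curved (\<lambda>t. F (0, t))"
  shows "\<exists>\<delta>>0. \<forall>e. \<bar>e\<bar> < \<delta> \<longrightarrow> strictly_pos_curved (\<lambda>t. F (e, t))"
proof -
  define w where "w p = area_form (P2 F p) ((P2 ^^ 2) F p)" for p
  define K where "K p = jet_curv (P2 F p) ((P2 ^^ 2) F p) ((P2 ^^ 3) F p) ((P2 ^^ 4) F p)" for p
  note cont = smooth2_continuous[OF smooth2_P2_funpow[OF F]] smooth2_continuous[OF smooth2_P2[OF F]]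
  have speed: "affine_speed (\<lambda>t. F (e, t)) t = w (e, t)" for e t
    by (simp add: section_curvature[OF F] w_def)
  have curv: "aff_curv (\<lambda>t. F (e, t)) t = K (e, t)" if "\<And>t. w (e, t) > 0" for e t
    using that by (simp add: section_curvature(2)[OF F] speed K_def)
  note per_all = P2_funpow_periodic[of F L, OF F per]
  have per_wK: "w (e, t + L) = w (e, t)" "K (e, t + L) = K (e, t)" for e t
    using per_all[of 1] by (simp_all add: w_def K_def per_all)
  \<comment> \<open>\<open>K\<close> contains negative powers of the speed and is shown to be
    continuous only where \<open>w\<close> is positive; this set has to be open first.\<close>
  define S where "S = {p. w p > 0}"
  have "continuous_on UNIV w"
    unfolding w_def by (intro continuous_intros cont)
  then have "open S"
    unfolding S_def by (intro open_Collect_less continuous_intros)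
  have "continuous_on S K"
    unfolding K_def by (intro continuous_on_jet_curv cont) (simp add: S_def w_def)
  then have "open (S \<inter> K -` {0<..})"
    using \<open>open S\<close> by (intro continuous_open_preimage) auto
  moreover have "{0} \<times> {0..L} \<subseteq> S \<inter> K -` {0<..}"
  proof -
    have "w (0, t) > 0" for t
      using pos by (simp add: strictly_pos_curved_def speed)
    then show ?thesis
      using pos by (auto simp: strictly_pos_curved_def S_def curv)
  qed
  moreover have "compact ({0} \<times> {0..L} :: (real \<times> real) set)"
    by (intro compact_Times) auto
  ultimately obtain \<delta> where \<delta>: "\<delta> > 0" "{x. infdist x ({0} \<times> {0..L}) \<le> \<delta>} \<subseteq> S \<inter> K -` {0<..}"
    using assms(1) by (metis compact_in_open_separated Times_empty atLeastatMost_empty_iff2 insert_not_empty less_le_not_le)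
  have "strictly_pos_curved (\<lambda>t. F (e, t))" if "\<bar>e\<bar> < \<delta>" for e
  proof -
    have pos: "w (e, t) > 0 \<and> K (e, t) > 0" for t
    proof -
      obtain s where s: "0 \<le> s" "s < 0 + L" "\<And>h :: real \<Rightarrow> real. (\<And>t. h (t + L) = h t) \<Longrightarrow> h t = h s"
        using periodic_representative[OF \<open>L > 0\<close>] by metis
      have "infdist (e, s) ({0} \<times> {0..L}) \<le> dist (e, s) (0, s)"
        using s by (intro infdist_le) auto
      also have "\<dots> \<le> \<delta>"
        using that by (simp add: dist_Pair_Pair)
      finally have "w (e, s) > 0 \<and> K (e, s) > 0"
        using \<delta>(2) by (auto simp: S_def)
      then show ?thesis
        using s(3)[of "\<lambda>t. w (e, t)"] s(3)[of "\<lambda>t. K (e, t)"] per_wK by simp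
    qed
    then show ?thesis
      by (simp add: strictly_pos_curved_def speed curv)
  qed
  then show ?thesis
    using \<delta>(1) by blast
qed

locale unit_speed_curve =
  fixes \<gamma> :: "real \<Rightarrow> real \<times> real" and L :: real
  assumes L_pos: "L > 0"
    and smooth: "smooth_curve \<gamma>"
    and periodic: "periodic_curve \<gamma> L"
    and unit_speed: "affine_speed \<gamma> t = 1"
    and curv_pos: "aff_curv \<gamma> t > 0"
begin

abbreviation "T \<equiv> vd \<gamma>"
abbreviation "N \<equiv> vd (vd \<gamma>)"
abbreviation "\<kappa> \<equiv> aff_curv \<gamma>"

definition p :: "real \<Rightarrow> real" where "p t = \<kappa> t powr (-1/2)"

lemma d\<gamma>: "(\<gamma> has_vector_derivative T t) (at t)"
  and dT: "(T has_vector_derivative N t) (at t)"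
  and dN_vd: "(N has_vector_derivative vd N t) (at t)"
  using smooth_curve_has_vd[OF smooth, of 0] smooth_curve_has_vd[OF smooth, of 1]
    smooth_curve_has_vd[OF smooth, of 2] by (simp_all add: eval_nat_numeral)

lemma TN: "area_form (T t) (N t) = 1"
  using unit_speed by (simp add: affine_speed_def)

lemma NT: "area_form (N t) (T t) = - 1"
  using TN[of t] area_form_swap[of "T t" "N t"] by simp

lemma Ds_eq: "Ds \<gamma> f = vd f"
  by (auto simp: Ds_def unit_speed)

lemma \<kappa>_eq: "\<kappa> t = area_form (N t) (vd N t)"
  by (simp add: aff_curv_def aff_N_def aff_T_def Ds_eq)

text \<open>Differentiating |T, N| = 1 leaves |T, N'| = 0, so N' is a multiple of T, with the factor
  read off from \<open>\<kappa>_eq\<close>.\<close>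

lemma vd_N: "vd N t = - \<kappa> t *\<^sub>R T t"
proof -
  have "((\<lambda>t. area_form (T t) (N t)) has_real_derivative area_form (T t) (vd N t) + area_form (N t) (N t)) (at t)"
    by (intro has_real_derivative_area_form dT dN_vd)
  then have "((\<lambda>_. 1) has_real_derivative area_form (T t) (vd N t)) (at t)"
    by (simp add: TN)
  then have "area_form (T t) (vd N t) = 0"
    by (rule DERIV_unique) (rule DERIV_const)
  then show ?thesis
    using area_form_basis[OF TN, of "vd N t" t] by (simp add: \<kappa>_eq area_form_swap[of "vd N t"])
qed

lemma dN: "(N has_vector_derivative - \<kappa> t *\<^sub>R T t) (at t)"
  using dN_vd by (simp add: vd_N)

section \<open>The algebra of test functions\<close>

inductive_set A :: "(real \<Rightarrow> real) set" where
  const: "(\<lambda>_. a) \<in> A"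
| fst_vd: "(\<lambda>t. fst ((vd ^^ i) \<gamma> t)) \<in> A"
| snd_vd: "(\<lambda>t. snd ((vd ^^ i) \<gamma> t)) \<in> A"
| p: "p \<in> A"
| add: "f \<in> A \<Longrightarrow> g \<in> A \<Longrightarrow> (\<lambda>t. f t + g t) \<in> A"
| mult: "f \<in> A \<Longrightarrow> g \<in> A \<Longrightarrow> (\<lambda>t. f t * g t) \<in> A"

lemma A_diff: "f \<in> A \<Longrightarrow> g \<in> A \<Longrightarrow> (\<lambda>t. f t - g t) \<in> A"
  using A.add[of f "\<lambda>t. (-1) * g t"] A.mult[OF A.const[of "-1"], of g] by simp

lemma A_divide: "f \<in> A \<Longrightarrow> (\<lambda>t. f t / a) \<in> A"
  using A.mult[OF _ A.const[of "1/a"], of f] by simp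

lemma A_power: "f \<in> A \<Longrightarrow> (\<lambda>t. f t ^ n) \<in> A"
  by (induction n) (auto intro: A.intros)

lemma A_area_form: "(\<lambda>t. area_form ((vd ^^ i) \<gamma> t) ((vd ^^ j) \<gamma> t)) \<in> A"
  unfolding area_form_def by (intro A_diff A.intros)

lemma \<kappa>_A: "\<kappa> \<in> A"
  using A_area_form[of 2 3] by (simp add: \<kappa>_eq[abs_def] eval_nat_numeral)

lemma p_pos: "p t > 0"
  using curv_pos[of t] by (simp add: p_def)

lemma sqrt_\<kappa>: "sqrt (\<kappa> t) = 1 / p t"
  using curv_pos[of t] by (simp add: p_def powr_minus_divide powr_half_sqrt)

lemma \<kappa>_p: "\<kappa> t = 1 / (p t)\<^sup>2"
  using curv_pos[of t] by (simp add: p_def powr_minus_divide power_divide powr_half_sqrt)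

text \<open>Only the generator \<open>p\<close> needs thought: \<kappa> is a polynomial in the
  derivatives of the curve, and \<open>p' = - p^3 \<kappa>' / 2\<close> stays in \<open>A\<close>.
  Membership and differentiability are proved together because the product rule needs both.\<close>

lemma A_deriv: "f \<in> A \<Longrightarrow> deriv f \<in> A \<and> (\<forall>t. (f has_real_derivative deriv f t) (at t))"
proof -
  have I: "deriv f \<in> A \<and> (\<forall>t. (f has_real_derivative deriv f t) (at t))"
    if "f' \<in> A" "\<And>t. (f has_real_derivative f' t) (at t)" for f f'
  proof -
    have "deriv f = f'"
      using that(2) by (intro ext DERIV_imp_deriv)
    then show ?thesis
      using that by simp
  qed
  show "f \<in> A \<Longrightarrow> ?thesis"
  proof (induction rule: A.induct)
    case (const a)
    show ?case
      by (rule I[OF A.const[of 0]]) simp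
  next
    case (fst_vd i)
    show ?case
      using bounded_linear.has_vector_derivative[OF bounded_linear_fst smooth_curve_has_vd[OF smooth, of i]]
      by (intro I[OF A.fst_vd[of "Suc i"]]) (simp add: has_real_derivative_iff_has_vector_derivative)
  next
    case (snd_vd i)
    show ?case
      using bounded_linear.has_vector_derivative[OF bounded_linear_snd smooth_curve_has_vd[OF smooth, of i]]
      by (intro I[OF A.snd_vd[of "Suc i"]]) (simp add: has_real_derivative_iff_has_vector_derivative)
  next
    case p
    let ?\<kappa>' = "\<lambda>t. area_form (vd N t) (vd N t) + area_form (N t) ((vd ^^ 4) \<gamma> t)"
    have "(\<kappa> has_real_derivative ?\<kappa>' t) (at t)" for t
      unfolding \<kappa>_eq[abs_def]
      using has_real_derivative_area_form[OF dN_vd smooth_curve_has_vd[OF smooth, of 3, simplified]]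
      by (simp add: eval_nat_numeral add.commute)
    from DERIV_fun_powr[OF this curv_pos, where r = "-1/2"]
    have "(p has_real_derivative (-1/2) * \<kappa> t powr (-1/2 - 1) * ?\<kappa>' t) (at t)" for t
      by (simp add: p_def[abs_def])
    then have dp: "(p has_real_derivative (-1/2) * p t ^ 3 * ?\<kappa>' t) (at t)" for t
      using curv_pos[of t] by (simp add: p_def powr_power)
    have "(\<lambda>t. (-1/2) * p t ^ 3 * ?\<kappa>' t) \<in> A"
      using A_area_form[of 2 4] A_area_form[of 3 3]
      by (intro A.add A.mult A_power A.const A.p) (simp_all add: eval_nat_numeral)
    then show ?case
      by (rule I) (rule dp)
  next
    case (add f g)
    then show ?case
      by (intro I[OF A.add[of "deriv f" "deriv g"]] derivative_intros) auto
  next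
    case (mult f g)
    then have "(\<lambda>t. deriv f t * g t + deriv g t * f t) \<in> A"
      by (intro A.intros) auto
    then show ?case
      by (rule I) (rule DERIV_mult; use mult in auto)
  qed
qed

lemma A_has_deriv: "f \<in> A \<Longrightarrow> (f has_real_derivative deriv f t) (at t)"
  by (simp add: A_deriv)

lemma A_continuous: "f \<in> A \<Longrightarrow> continuous_on S f"
  by (meson A_has_deriv DERIV_isCont continuous_at_imp_continuous_on)

lemma A_integrable: "f \<in> A \<Longrightarrow> f integrable_on {a..b}"
  by (rule integrable_continuous_interval[OF A_continuous])

lemma vd_periodic: "(vd ^^ i) \<gamma> (t + L) = (vd ^^ i) \<gamma> t"
proof (induction i arbitrary: t)
  case 0
  then show ?case
    using periodic by (simp add: periodic_curve_def)
next
  case (Suc i)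
  then show ?case
    using periodic_derivative[OF smooth_curve_has_vd[OF smooth, of i] Suc] by simp
qed

lemma A_periodic: "f \<in> A \<Longrightarrow> f (t + L) = f t"
proof (induction rule: A.induct)
  case p
  have "vd N (t + L) = vd N t" "N (t + L) = N t"
    using vd_periodic[of 3 t] vd_periodic[of 2 t] by (simp_all add: eval_nat_numeral)
  then show ?case
    by (simp add: p_def \<kappa>_eq)
qed (simp_all add: vd_periodic)

lemma A_integral_deriv:
  assumes "f \<in> A"
  shows "integral {0..L} (deriv f) = 0"
proof -
  have "(deriv f has_integral f L - f 0) {0..L}"
    using L_pos A_has_deriv[OF assms]
    by (intro fundamental_theorem_of_calculus)
      (auto simp: has_real_derivative_iff_has_vector_derivative intro: has_vector_derivative_at_within)
  then show ?thesis
    using A_periodic[OF assms, of 0] by (simp add: integral_unique)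
qed

end

section \<open>Normal variations\<close>

context unit_speed_curve
begin

lemma A_pair_has_vd:
  assumes "f \<in> A" "g \<in> A"
  shows "((\<lambda>t. (f t, g t)) has_vector_derivative (deriv f t, deriv g t)) (at t)"
  using A_has_deriv[OF assms(1)] A_has_deriv[OF assms(2)]
  by (auto intro!: has_vector_derivative_Pair simp: has_real_derivative_iff_has_vector_derivative[symmetric])

text \<open>Families affine in \<open>e\<close> are closed under both partial derivatives: one has
  the coefficients \<open>b\<close> and 0, the other \<open>deriv a\<close> and
  \<open>deriv b\<close>. Hence the induction runs over all coefficients in
  \<open>A\<close>.\<close>

lemma Ck2_affine_family:
  assumes "a1 \<in> A" "a2 \<in> A" "b1 \<in> A" "b2 \<in> A"
  shows "Ck2 k (\<lambda>p. (a1 (snd p) + fst p * b1 (snd p), a2 (snd p) + fst p * b2 (snd p)))"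
  using assms
proof (induction k arbitrary: a1 a2 b1 b2)
  case 0
  have "continuous_on UNIV (\<lambda>p :: real \<times> real. f (snd p))" if "f \<in> A" for f
    by (rule continuous_on_compose2[OF A_continuous[OF that, of UNIV]]) (auto intro!: continuous_intros)
  then show ?case
    using 0 by (auto intro!: continuous_intros)
next
  case (Suc k)
  let ?F = "\<lambda>a1 b1 a2 b2 p. (a1 (snd p) + fst p * b1 (snd p), a2 (snd p) + fst p * b2 (snd p)) :: real \<times> real"
  let ?D1 = "?F b1 (\<lambda>_. 0) b2 (\<lambda>_. 0)"
  let ?D2 = "?F (deriv a1) (deriv b1) (deriv a2) (deriv b2)"
  show ?case
    unfolding Ck2.simps
  proof (rule exI[of _ ?D1], rule exI[of _ ?D2], intro conjI allI)
    fix p :: "real \<times> real"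
    show "((\<lambda>u. ?F a1 b1 a2 b2 (u, snd p)) has_vector_derivative ?D1 p) (at (fst p))"
      by (auto intro!: has_vector_derivative_Pair derivative_eq_intros
          simp: has_real_derivative_iff_has_vector_derivative[symmetric])
    have "(\<lambda>t. a t + fst p * b t) \<in> A" if "a \<in> A" "b \<in> A" for a b
      using that by (intro A.intros)
    moreover have "deriv (\<lambda>t. a t + fst p * b t) = (\<lambda>t. deriv a t + fst p * deriv b t)"
      if "a \<in> A" "b \<in> A" for a b
      using A_has_deriv[OF that(1)] A_has_deriv[OF that(2)]
      by (intro ext DERIV_imp_deriv) (auto intro!: derivative_eq_intros)
    ultimately show "((\<lambda>v. ?F a1 b1 a2 b2 (fst p, v)) has_vector_derivative ?D2 p) (at (snd p))"
      using A_pair_has_vd[of "\<lambda>t. a1 t + fst p * b1 t" "\<lambda>t. a2 t + fst p * b2 t" "snd p"] Suc.prems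
      by simp
  qed (intro Suc A.const conjunct1[OF A_deriv])+
qed

definition normal_var :: "(real \<Rightarrow> real) \<Rightarrow> real \<times> real \<Rightarrow> real \<times> real" where
  "normal_var f = (\<lambda>(e, t). \<gamma> t + (e * f t) *\<^sub>R N t)"

lemma smooth2_normal_var:
  assumes "f \<in> A"
  shows "smooth2 (normal_var f)"
proof -
  have "normal_var f = (\<lambda>p. (fst (\<gamma> (snd p)) + fst p * (f (snd p) * fst (N (snd p))),
      snd (\<gamma> (snd p)) + fst p * (f (snd p) * snd (N (snd p)))))"
    by (auto simp: normal_var_def intro!: prod_eqI)
  moreover have "(\<lambda>t. fst (\<gamma> t)) \<in> A" "(\<lambda>t. snd (\<gamma> t)) \<in> A"
    "(\<lambda>t. f t * fst (N t)) \<in> A" "(\<lambda>t. f t * snd (N t)) \<in> A"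
    using A.fst_vd[of 0] A.snd_vd[of 0] A.fst_vd[of 2] A.snd_vd[of 2]
    by (auto intro!: A.mult assms simp: eval_nat_numeral)
  ultimately show ?thesis
    using Ck2_affine_family[of "\<lambda>t. fst (\<gamma> t)" "\<lambda>t. snd (\<gamma> t)" "\<lambda>t. f t * fst (N t)" "\<lambda>t. f t * snd (N t)"]
    by (simp add: smooth2_def)
qed

lemma admissible_normal_var:
  assumes "f \<in> A"
  shows "admissible_variation (\<lambda>e t. normal_var f (e, t)) \<gamma> L"
proof -
  have per: "normal_var f (e, t + L) = normal_var f (e, t)" for e t
    using vd_periodic[of 0 t] vd_periodic[of 2 t] A_periodic[OF assms, of t]
    by (simp add: normal_var_def eval_nat_numeral)
  have zero: "(\<lambda>t. normal_var f (0, t)) = \<gamma>"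
    by (simp add: normal_var_def)
  have "strictly_pos_curved (\<lambda>t. normal_var f (0, t))"
    using curv_pos by (simp add: zero strictly_pos_curved_def unit_speed)
  from smooth2_section_positive[OF L_pos smooth2_normal_var[OF assms] per this] per
  show ?thesis
    by (simp add: admissible_variation_def smooth2_normal_var[OF assms] zero periodic_curve_def)
qed

text \<open>By T' = N and N' = - \<kappa> T, differentiation becomes a rule on coefficient pairs,
  which is iterated below for normal fields.\<close>

lemma vd_frame:
  assumes "\<And>t. (f has_real_derivative f' t) (at t)" "\<And>t. (g has_real_derivative g' t) (at t)"
  shows "vd (\<lambda>t. f t *\<^sub>R T t + g t *\<^sub>R N t) =
    (\<lambda>t. (f' t - \<kappa> t * g t) *\<^sub>R T t + (f t + g' t) *\<^sub>R N t)"
proof (rule vd_eqI)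
  fix t
  have "((\<lambda>t. f t *\<^sub>R T t + g t *\<^sub>R N t) has_vector_derivative
      (f t *\<^sub>R N t + f' t *\<^sub>R T t) + (g t *\<^sub>R (- \<kappa> t *\<^sub>R T t) + g' t *\<^sub>R N t)) (at t)"
    by (intro has_vector_derivative_add has_vector_derivative_scaleR assms dT dN)
  then show "((\<lambda>t. f t *\<^sub>R T t + g t *\<^sub>R N t) has_vector_derivative
      (f' t - \<kappa> t * g t) *\<^sub>R T t + (f t + g' t) *\<^sub>R N t) (at t)"
    by (simp add: algebra_simps)
qed

text \<open>The T-component of the fourth derivative is left as an unspecified \<open>x\<close>:
  that derivative enters the first variation only through |T, V4|, which sees the N-component
  alone.\<close>

lemma vd_normal_field:
  assumes "f \<in> A"
  defines "f1 \<equiv> deriv f" and "f2 \<equiv> deriv (deriv f)" and "f3 \<equiv> deriv (deriv (deriv f))"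
    and "f4 \<equiv> deriv (deriv (deriv (deriv f)))" and "k1 \<equiv> deriv \<kappa>" and "k2 \<equiv> deriv (deriv \<kappa>)"
  shows "vd (\<lambda>t. f t *\<^sub>R N t) = (\<lambda>t. (- \<kappa> t * f t) *\<^sub>R T t + f1 t *\<^sub>R N t)" (is ?V1)
    and "(vd ^^ 2) (\<lambda>t. f t *\<^sub>R N t) =
      (\<lambda>t. (- (k1 t * f t + 2 * \<kappa> t * f1 t)) *\<^sub>R T t + (f2 t - \<kappa> t * f t) *\<^sub>R N t)" (is ?V2)
    and "(vd ^^ 3) (\<lambda>t. f t *\<^sub>R N t) =
      (\<lambda>t. (- 3 * \<kappa> t * f2 t - 3 * k1 t * f1 t + ((\<kappa> t)\<^sup>2 - k2 t) * f t) *\<^sub>R T t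
        + (f3 t - 3 * \<kappa> t * f1 t - 2 * k1 t * f t) *\<^sub>R N t)" (is ?V3)
    and "\<exists>x. (vd ^^ 4) (\<lambda>t. f t *\<^sub>R N t) =
      (\<lambda>t. x t *\<^sub>R T t + (f4 t - 6 * \<kappa> t * f2 t - 8 * k1 t * f1 t + ((\<kappa> t)\<^sup>2 - 3 * k2 t) * f t) *\<^sub>R N t)"
proof -
  have A: "f1 \<in> A" "f2 \<in> A" "f3 \<in> A" "k1 \<in> A" "k2 \<in> A"
    using assms \<kappa>_A by (auto simp: A_deriv)
  note d = A_has_deriv[OF assms(1), folded f1_def] A_has_deriv[OF A(1), unfolded f1_def, folded f1_def f2_def]
    A_has_deriv[OF A(2), unfolded f2_def, folded f2_def f3_def]
    A_has_deriv[OF A(3), unfolded f3_def, folded f3_def f4_def]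
    A_has_deriv[OF \<kappa>_A, folded k1_def] A_has_deriv[OF A(4), unfolded k1_def, folded k1_def k2_def]
    A_has_deriv[OF A(5)]
  show V1: ?V1
    using vd_frame[of "\<lambda>_. 0" "\<lambda>_. 0" f f1] d by simp
  have "vd (\<lambda>t. (- \<kappa> t * f t) *\<^sub>R T t + f1 t *\<^sub>R N t) = (\<lambda>t. (- (k1 t * f t + \<kappa> t * f1 t) - \<kappa> t * f1 t) *\<^sub>R T t
      + (- \<kappa> t * f t + f2 t) *\<^sub>R N t)"
    by (intro vd_frame; (rule derivative_eq_intros d refl)+; simp add: algebra_simps)
  then show V2: ?V2
    by (simp add: V1 eval_nat_numeral algebra_simps)
  have "vd (\<lambda>t. (- (k1 t * f t + 2 * \<kappa> t * f1 t)) *\<^sub>R T t + (f2 t - \<kappa> t * f t) *\<^sub>R N t) =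
     (\<lambda>t. (- (k2 t * f t + k1 t * f1 t + 2 * (k1 t * f1 t + \<kappa> t * f2 t)) - \<kappa> t * (f2 t - \<kappa> t * f t)) *\<^sub>R T t
      + (- (k1 t * f t + 2 * \<kappa> t * f1 t) + (f3 t - k1 t * f t - \<kappa> t * f1 t)) *\<^sub>R N t)"
    by (intro vd_frame; (rule derivative_eq_intros d refl)+; simp add: algebra_simps)
  moreover have "(vd ^^ 3) (\<lambda>t. f t *\<^sub>R N t) = vd ((vd ^^ 2) (\<lambda>t. f t *\<^sub>R N t))"
    by (simp add: eval_nat_numeral)
  ultimately show V3: ?V3
    unfolding V2 by (intro ext) (simp add: power2_eq_square algebra_simps)
  let ?x = "\<lambda>t. - 3 * \<kappa> t * f2 t - 3 * k1 t * f1 t + ((\<kappa> t)\<^sup>2 - k2 t) * f t"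
  have "?x \<in> A"
    using A \<kappa>_A assms(1) by (intro A.intros A_diff A_power)
  have "vd (\<lambda>t. ?x t *\<^sub>R T t + (f3 t - 3 * \<kappa> t * f1 t - 2 * k1 t * f t) *\<^sub>R N t) =
     (\<lambda>t. (deriv ?x t - \<kappa> t * (f3 t - 3 * \<kappa> t * f1 t - 2 * k1 t * f t)) *\<^sub>R T t
      + (?x t + (f4 t - 3 * (k1 t * f1 t + \<kappa> t * f2 t) - 2 * (k2 t * f t + k1 t * f1 t))) *\<^sub>R N t)"
    by (intro vd_frame A_has_deriv \<open>?x \<in> A\<close>; (rule derivative_eq_intros d refl)+; simp add: algebra_simps)
  moreover have "(vd ^^ 4) (\<lambda>t. f t *\<^sub>R N t) = vd ((vd ^^ 3) (\<lambda>t. f t *\<^sub>R N t))"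
    by (simp add: eval_nat_numeral)
  ultimately show "\<exists>x. (vd ^^ 4) (\<lambda>t. f t *\<^sub>R N t) =
      (\<lambda>t. x t *\<^sub>R T t + (f4 t - 6 * \<kappa> t * f2 t - 8 * k1 t * f1 t + ((\<kappa> t)\<^sup>2 - 3 * k2 t) * f t) *\<^sub>R N t)"
    unfolding V3
    by (intro exI[of _ "\<lambda>t. deriv ?x t - \<kappa> t * (f3 t - 3 * \<kappa> t * f1 t - 2 * k1 t * f t)"] ext)
      (simp add: algebra_simps)
qed

end

section \<open>Euler--Lagrange equations\<close>

lemma total_sqrt_curv_eq: "total_sqrt_curv = curv_integral sqrt"
  and affine_length_eq: "affine_length = curv_integral (\<lambda>_. 1)"
  and total_curv_eq: "total_curv = curv_integral (\<lambda>x. x)"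
  by (simp_all add: fun_eq_iff total_sqrt_curv_def affine_length_def total_curv_def curv_integral_def)

context unit_speed_curve
begin

text \<open>With \<open>t\<close> held fixed, \<open>f N\<close> changes \<kappa> by \<open>(f'''' +
  5 (\<kappa> f')' + (\<kappa>'' + 4 \<kappa>^2) f) / 3\<close> and the length element by the factor
  \<open>(f'' - 2 \<kappa> f) / 3\<close>. Both operators are formally self-adjoint, so after
  integration by parts they act unchanged on \<open>m\<close> and \<open>n\<close>; up to the factor
  1/3, \<open>E\<close> is the sum.\<close>

lemma normal_variation_curv_integral:
  assumes f: "f \<in> A" and m: "m \<in> A" and n: "n \<in> A"
    and \<psi>: "\<And>x. x > 0 \<Longrightarrow> (\<psi> has_real_derivative \<psi>' x) (at x)" "continuous_on {0<..} \<psi>'"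
    and mn: "\<And>t. \<psi>' (\<kappa> t) = m t" "\<And>t. \<psi> (\<kappa> t) = n t"
  defines "E \<equiv> \<lambda>t. deriv (deriv (deriv (deriv m))) t
      + 5 * (\<kappa> t * deriv (deriv m) t + deriv \<kappa> t * deriv m t)
      + (deriv (deriv \<kappa>) t + 4 * (\<kappa> t)\<^sup>2) * m t + deriv (deriv n) t - 2 * \<kappa> t * n t"
  shows "((\<lambda>e. curv_integral \<psi> L (\<lambda>t. normal_var f (e, t))) has_real_derivative
     integral {0..L} (\<lambda>t. f t * E t) / 3) (at 0)"
proof -
  let ?F = "normal_var f"
  define c where "c i t = (P2 ^^ i) ?F (0, t)" for i t
  define V where "V i t = P1 ((P2 ^^ i) ?F) (0, t)" for i t
  note F = smooth2_normal_var[OF f]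
  have zero: "(\<lambda>t. ?F (0, t)) = \<gamma>"
    by (simp add: normal_var_def)
  have c: "c i = (vd ^^ i) \<gamma>" for i
    using vd_funpow_section[OF F, of i 0] by (simp add: c_def[abs_def] zero)
  have "P1 ?F (0, t) = f t *\<^sub>R N t" for t
  proof -
    have "((\<lambda>u. ?F (u, t)) has_vector_derivative f t *\<^sub>R N t) (at 0)"
      unfolding normal_var_def by (auto intro!: derivative_eq_intros)
    then show ?thesis
      using smooth2_has_P1[OF F, of t 0] by (blast intro: vector_derivative_unique_at)
  qed
  then have V: "V i = (vd ^^ i) (\<lambda>t. f t *\<^sub>R N t)" for i
    using vd_funpow_section[OF smooth2_P1[OF F], of i 0]
    by (simp add: V_def[abs_def] P2_funpow_P1[OF F])
  obtain \<delta> where \<delta>: "\<delta> > 0" "\<And>e. \<bar>e\<bar> < \<delta> \<Longrightarrow> strictly_pos_curved (\<lambda>t. ?F (e, t))"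
    using admissible_normal_var[OF f] by (auto simp: admissible_variation_def)
  define f1 f2 f3 f4 where fs: "f1 = deriv f" "f2 = deriv (deriv f)" "f3 = deriv (deriv (deriv f))"
    "f4 = deriv (deriv (deriv (deriv f)))"
  define m1 m2 m3 m4 where ms: "m1 = deriv m" "m2 = deriv (deriv m)" "m3 = deriv (deriv (deriv m))"
    "m4 = deriv (deriv (deriv (deriv m)))"
  define n1 n2 where ns: "n1 = deriv n" "n2 = deriv (deriv n)"
  define k1 k2 where ks: "k1 = deriv \<kappa>" "k2 = deriv (deriv \<kappa>)"
  note defs = fs ms ns ks
  have in_A: "f1 \<in> A" "f2 \<in> A" "f3 \<in> A" "f4 \<in> A" "m1 \<in> A" "m2 \<in> A" "m3 \<in> A" "m4 \<in> A"
      "n1 \<in> A" "n2 \<in> A" "k1 \<in> A" "k2 \<in> A"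
    unfolding defs by (simp_all add: A_deriv f m n \<kappa>_A)
  have d: "(f has_real_derivative f1 t) (at t)" "(f1 has_real_derivative f2 t) (at t)"
    "(f2 has_real_derivative f3 t) (at t)" "(f3 has_real_derivative f4 t) (at t)"
    "(m has_real_derivative m1 t) (at t)" "(m1 has_real_derivative m2 t) (at t)"
    "(m2 has_real_derivative m3 t) (at t)" "(m3 has_real_derivative m4 t) (at t)"
    "(n has_real_derivative n1 t) (at t)" "(n1 has_real_derivative n2 t) (at t)"
    "(\<kappa> has_real_derivative k1 t) (at t)" for t
    unfolding defs by (simp_all add: A_deriv f m n \<kappa>_A)
  note normal = vd_normal_field[OF f, folded defs]
  obtain x4 where V4: "V 4 = (\<lambda>t. x4 t *\<^sub>R T t
      + (f4 t - 6 * \<kappa> t * f2 t - 8 * k1 t * f1 t + ((\<kappa> t)\<^sup>2 - 3 * k2 t) * f t) *\<^sub>R N t)"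
    using normal(4) by (auto simp: V)
  have V1: "V 1 = (\<lambda>t. (- \<kappa> t * f t) *\<^sub>R T t + f1 t *\<^sub>R N t)"
    using normal(1) by (simp add: V)
  have cs: "c 1 = T" "c 2 = N" "c 3 t = - \<kappa> t *\<^sub>R T t" "c 4 t = - k1 t *\<^sub>R T t - \<kappa> t *\<^sub>R N t" for t
  proof -
    show "c 1 = T" "c 2 = N" "c 3 t = - \<kappa> t *\<^sub>R T t"
      by (simp_all add: c eval_nat_numeral vd_N)
    have "vd (vd N) = (\<lambda>t. (- k1 t) *\<^sub>R T t + (- \<kappa> t) *\<^sub>R N t)"
      using vd_frame[of "\<lambda>t. - \<kappa> t" "\<lambda>t. - k1 t" "\<lambda>_. 0" "\<lambda>_. 0"] d
      by (simp add: vd_N[abs_def] DERIV_minus)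
    then show "c 4 t = - k1 t *\<^sub>R T t - \<kappa> t *\<^sub>R N t"
      by (simp add: c eval_nat_numeral)
  qed
  have dw: "area_form (c 1 t) (V 2 t) + area_form (V 1 t) (c 2 t) = f2 t - 2 * \<kappa> t * f t" for t
    by (simp add: cs V1 V[of 2] normal area_form_simps TN del: One_nat_def)
  \<comment> \<open>Integration by parts moves all derivatives from f to m and n, with boundary term B.\<close>
  define B where "B t = (m t * f3 t - m1 t * f2 t + m2 t * f1 t - m3 t * f t
      + 5 * (\<kappa> t * m t * f1 t - \<kappa> t * m1 t * f t) + n t * f1 t - n1 t * f t) / 3" for t
  have B: "B \<in> A"
    unfolding B_def[abs_def] using in_A f m n \<kappa>_A by (intro A_divide A_diff A.intros)
  have dB: "deriv B t = (m t * f4 t - m4 t * f t + 5 * (k1 t * m t * f1 t + \<kappa> t * m t * f2 t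
      - k1 t * m1 t * f t - \<kappa> t * m2 t * f t) + n t * f2 t - n2 t * f t) / 3" for t
    unfolding B_def[abs_def]
    by (rule DERIV_imp_deriv, (rule derivative_eq_intros d refl numeral_neq_zero)+) (simp add: field_simps)
  have E_eq: "E t = m4 t + 5 * (\<kappa> t * m2 t + k1 t * m1 t) + (k2 t + 4 * (\<kappa> t)\<^sup>2) * m t
      + n2 t - 2 * \<kappa> t * n t" for t
    by (simp add: E_def defs)
  have integrand: "m t * (-5/3 * \<kappa> t * (area_form (c 1 t) (V 2 t) + area_form (V 1 t) (c 2 t))
          + 4/3 * (area_form (c 2 t) (V 3 t) + area_form (V 2 t) (c 3 t))
          + (area_form (c 1 t) (V 4 t) + area_form (V 1 t) (c 4 t)) / 3)
        + n t * (area_form (c 1 t) (V 2 t) + area_form (V 1 t) (c 2 t)) / 3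
      = f t * E t / 3 + deriv B t" for t
    unfolding dw
    by (simp add: cs V1 V4 V[of 2] V[of 3] normal area_form_simps TN NT dB E_eq del: One_nat_def)
      (simp add: algebra_simps power2_eq_square add_divide_distrib diff_divide_distrib)
  have "E \<in> A"
    unfolding E_def using \<kappa>_A m n
    by (intro A_diff A.intros A_power) (simp_all add: A_deriv)
  then have "integral {0..L} (\<lambda>t. f t * E t / 3 + deriv B t) = integral {0..L} (\<lambda>t. f t * E t / 3) + integral {0..L} (deriv B)"
    using f B by (intro integral_add A_integrable A_divide A.mult) (simp_all add: A_deriv)
  then have int: "integral {0..L} (\<lambda>t. f t * E t / 3 + deriv B t) = integral {0..L} (\<lambda>t. f t * E t) / 3"
    by (simp add: A_integral_deriv[OF B])
  have unit: "affine_speed (c 0) t = 1" for t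
    by (simp add: c unit_speed)
  have "(\<lambda>t. c 0 t) = \<gamma>"
    by (simp add: c)
  then show ?thesis
    using first_variation_curv_integral[OF F \<delta> unit[unfolded c_def] \<psi>, of L]
    unfolding c_def[symmetric] V_def[symmetric]
    by (simp only: mn integrand int)
qed

lemma normal_variation_sqrt_curv:
  assumes "f \<in> A"
  shows "((\<lambda>e. total_sqrt_curv L (\<lambda>t. normal_var f (e, t))) has_real_derivative
    integral {0..L} (\<lambda>t. f t * (deriv (deriv (deriv (deriv p))) t + \<kappa> t * deriv (deriv p) t)) / 6) (at 0)"
proof -
  \<comment> \<open>\<open>?n\<close> is 1 / \<open>p\<close>, written as a product so that its
    membership in \<open>A\<close> is visible.\<close>
  let ?m = "\<lambda>t. p t / 2" and ?n = "\<lambda>t. \<kappa> t * p t"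
  define p1 p2 p3 p4 where ps: "p1 = deriv p" "p2 = deriv (deriv p)" "p3 = deriv (deriv (deriv p))"
    "p4 = deriv (deriv (deriv (deriv p)))"
  define k1 k2 where ks: "k1 = deriv \<kappa>" "k2 = deriv (deriv \<kappa>)"
  have d: "(p has_real_derivative p1 t) (at t)" "(p1 has_real_derivative p2 t) (at t)"
    "(p2 has_real_derivative p3 t) (at t)" "(p3 has_real_derivative p4 t) (at t)"
    "(\<kappa> has_real_derivative k1 t) (at t)" "(k1 has_real_derivative k2 t) (at t)" for t
    unfolding ps ks by (simp_all add: A_deriv A.p \<kappa>_A)
  have dm: "deriv ?m = (\<lambda>t. p1 t / 2)" "deriv (\<lambda>t. p1 t / 2) = (\<lambda>t. p2 t / 2)"
    "deriv (\<lambda>t. p2 t / 2) = (\<lambda>t. p3 t / 2)" "deriv (\<lambda>t. p3 t / 2) = (\<lambda>t. p4 t / 2)"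
    by (rule ext, rule DERIV_imp_deriv, rule DERIV_cdivide, rule d)+
  have dn1: "deriv ?n = (\<lambda>t. k1 t * p t + \<kappa> t * p1 t)"
    by (rule ext, rule DERIV_imp_deriv) (auto intro!: derivative_eq_intros d)
  have dn2: "deriv (\<lambda>t. k1 t * p t + \<kappa> t * p1 t) = (\<lambda>t. k2 t * p t + 2 * k1 t * p1 t + \<kappa> t * p2 t)"
    by (rule ext, rule DERIV_imp_deriv) (auto intro!: derivative_eq_intros d simp: algebra_simps)
  \<comment> \<open>The relations obtained by differentiating \<open>\<kappa> p\<^sup>2 = 1\<close> once and twice.\<close>
  have rel0: "\<kappa> t * (p t)\<^sup>2 = 1" for t
    using p_pos[of t] by (simp add: \<kappa>_p)
  have rel1: "k1 t * p t + 2 * \<kappa> t * p1 t = 0" for t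
  proof -
    have "((\<lambda>t. \<kappa> t * (p t)\<^sup>2) has_real_derivative p t * (k1 t * p t + 2 * \<kappa> t * p1 t)) (at t)"
      by (auto intro!: derivative_eq_intros d simp: power2_eq_square algebra_simps)
    then have "((\<lambda>t. 1) has_real_derivative p t * (k1 t * p t + 2 * \<kappa> t * p1 t)) (at t)"
      by (simp add: rel0)
    then have "p t * (k1 t * p t + 2 * \<kappa> t * p1 t) = 0"
      by (rule DERIV_unique) (rule DERIV_const)
    then show ?thesis
      using p_pos[of t] by simp
  qed
  have rel2: "k2 t * p t + 3 * k1 t * p1 t + 2 * \<kappa> t * p2 t = 0" for t
  proof -
    have "((\<lambda>t. k1 t * p t + 2 * \<kappa> t * p1 t) has_real_derivative
        k2 t * p t + 3 * k1 t * p1 t + 2 * \<kappa> t * p2 t) (at t)"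
      by (auto intro!: derivative_eq_intros d simp: algebra_simps)
    then have "((\<lambda>t. 0) has_real_derivative k2 t * p t + 3 * k1 t * p1 t + 2 * \<kappa> t * p2 t) (at t)"
      by (simp add: rel1)
    then show ?thesis
      by (rule DERIV_unique) (rule DERIV_const)
  qed
  \<comment> \<open>The terms with \<kappa>^2 cancel, and the two sides then differ by 3/2 times the
    left side of \<open>rel2\<close>.\<close>
  have E: "p4 t / 2 + 5 * (\<kappa> t * (p2 t / 2) + k1 t * (p1 t / 2)) + (k2 t + 4 * (\<kappa> t)\<^sup>2) * (p t / 2)
      + (k2 t * p t + 2 * k1 t * p1 t + \<kappa> t * p2 t) - 2 * \<kappa> t * (\<kappa> t * p t)
    = (p4 t + \<kappa> t * p2 t) / 2" for t
    using rel2[of t] by (simp add: field_simps power2_eq_square)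
  have "((\<lambda>e. curv_integral sqrt L (\<lambda>t. normal_var f (e, t))) has_real_derivative
     integral {0..L} (\<lambda>t. f t * ((p4 t + \<kappa> t * p2 t) / 2)) / 3) (at 0)"
  proof (rule normal_variation_curv_integral[of f ?m ?n sqrt "\<lambda>x. x powr (-1/2) / 2", OF assms,
      folded ks, unfolded dm dn1 dn2 E])
    show "?m \<in> A" "?n \<in> A"
      by (intro A_divide A.mult A.p \<kappa>_A)+
    show "(sqrt has_real_derivative x powr (- 1 / 2) / 2) (at x)" if "x > 0" for x :: real
      using DERIV_real_sqrt[OF that] that by (simp add: powr_minus powr_half_sqrt)
    show "continuous_on {0<..} (\<lambda>x :: real. x powr (- 1 / 2) / 2)"
      by (intro continuous_intros) auto
    show "\<kappa> t powr (- 1 / 2) / 2 = p t / 2" for t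
      by (simp add: p_def)
    show "sqrt (\<kappa> t) = \<kappa> t * p t" for t
      unfolding sqrt_\<kappa> using p_pos[of t] by (simp add: \<kappa>_p power2_eq_square)
  qed
  then show ?thesis
    by (simp add: total_sqrt_curv_eq ps)
qed

lemma normal_variation_affine_length:
  assumes "f \<in> A"
  shows "((\<lambda>e. affine_length L (\<lambda>t. normal_var f (e, t))) has_real_derivative
    (-2/3) * integral {0..L} (\<lambda>t. f t * \<kappa> t)) (at 0)"
  using normal_variation_curv_integral[of f "\<lambda>_. 0" "\<lambda>_. 1" "\<lambda>_. 1" "\<lambda>_. 0", OF assms] A.const
  by (simp add: affine_length_eq mult.assoc mult.left_commute[of "f _" 2])

lemma normal_variation_total_curv:
  assumes "f \<in> A"
  shows "((\<lambda>e. total_curv L (\<lambda>t. normal_var f (e, t))) has_real_derivative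
    2/3 * integral {0..L} (\<lambda>t. f t * (deriv (deriv \<kappa>) t + (\<kappa> t)\<^sup>2))) (at 0)"
proof -
  have E: "f t * (2 * deriv (deriv \<kappa>) t + 4 * (\<kappa> t)\<^sup>2 - 2 * \<kappa> t * \<kappa> t)
      = 2 * (f t * (deriv (deriv \<kappa>) t + (\<kappa> t)\<^sup>2))" for t
    by (simp add: power2_eq_square algebra_simps)
  have "((\<lambda>e. curv_integral (\<lambda>x. x) L (\<lambda>t. normal_var f (e, t))) has_real_derivative
    integral {0..L} (\<lambda>t. 2 * (f t * (deriv (deriv \<kappa>) t + (\<kappa> t)\<^sup>2))) / 3) (at 0)"
    using normal_variation_curv_integral[of f "\<lambda>_. 1" \<kappa> "\<lambda>x. x" "\<lambda>_. 1", OF assms A.const \<kappa>_A]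
    by (simp add: E)
  then show ?thesis
    by (simp add: total_curv_eq)
qed

text \<open>Along \<open>normal_var f\<close> the area is a quadratic polynomial in
  \<open>e\<close>, so its derivative at 0 is simply the linear coefficient.\<close>

lemma normal_variation_area:
  assumes f: "f \<in> A"
  shows "((\<lambda>e. enclosed_area L (\<lambda>t. normal_var f (e, t))) has_real_derivative
    - integral {0..L} f) (at 0)"
proof -
  define f1 where "f1 = deriv f"
  have f1: "f1 \<in> A" "(f has_real_derivative f1 t) (at t)" for t
    using f by (simp_all add: f1_def A_deriv)
  define a0 where "a0 t = area_form (\<gamma> t) (T t) / 2" for t
  \<comment> \<open>The linear coefficient of the integrand is \<open>deriv B - f\<close>, and the
    periodic \<open>B\<close> contributes nothing to the integral.\<close>
  define B where "B t = f t * area_form (\<gamma> t) (N t) / 2" for t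
  define a2 where "a2 t = f t * f t * \<kappa> t / 2" for t
  have A: "a0 \<in> A" "B \<in> A" "a2 \<in> A" "deriv B \<in> A"
  proof -
    have "(\<lambda>t. area_form (\<gamma> t) (T t)) \<in> A" "(\<lambda>t. area_form (\<gamma> t) (N t)) \<in> A"
      using A_area_form[of 0 1] A_area_form[of 0 2] by (simp_all add: eval_nat_numeral)
    then show "a0 \<in> A" "B \<in> A" "a2 \<in> A"
      by (auto simp: a0_def[abs_def] B_def[abs_def] a2_def[abs_def] intro!: A_divide A.mult f \<kappa>_A)
    then show "deriv B \<in> A"
      by (simp add: A_deriv)
  qed
  have dB: "deriv B t = (f1 t * area_form (\<gamma> t) (N t) - f t * \<kappa> t * area_form (\<gamma> t) (T t) + f t) / 2" for t
    unfolding B_def[abs_def]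
    by (rule DERIV_imp_deriv)
      (auto intro!: derivative_eq_intros f1 d\<gamma> dN simp: area_form_simps TN field_simps)
  have vd: "vd (\<lambda>t. normal_var f (e, t)) = (\<lambda>t. T t + e *\<^sub>R (f1 t *\<^sub>R N t - (f t * \<kappa> t) *\<^sub>R T t))" for e
  proof (rule vd_eqI)
    fix t
    have "((\<lambda>t. \<gamma> t + (e * f t) *\<^sub>R N t) has_vector_derivative
        T t + ((e * f t) *\<^sub>R (- \<kappa> t *\<^sub>R T t) + (e * f1 t) *\<^sub>R N t)) (at t)"
      by (intro has_vector_derivative_add has_vector_derivative_scaleR d\<gamma> dN DERIV_cmult f1)
    then show "((\<lambda>t. normal_var f (e, t)) has_vector_derivative
        T t + e *\<^sub>R (f1 t *\<^sub>R N t - (f t * \<kappa> t) *\<^sub>R T t)) (at t)"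
      by (simp add: normal_var_def algebra_simps)
  qed
  have integrand: "area_form (normal_var f (e, t)) (vd (\<lambda>t. normal_var f (e, t)) t) / 2
      = a0 t + e * (deriv B t - f t) + e\<^sup>2 * a2 t" for e t
  proof -
    have "area_form (normal_var f (e, t)) (vd (\<lambda>t. normal_var f (e, t)) t) = area_form (\<gamma> t) (T t)
        + e * (f1 t * area_form (\<gamma> t) (N t) - f t * \<kappa> t * area_form (\<gamma> t) (T t) - f t)
        + e\<^sup>2 * (f t * f t * \<kappa> t)"
      unfolding vd by (simp add: normal_var_def area_form_simps NT TN)
        (simp add: algebra_simps power2_eq_square)
    moreover have "deriv B t - f t = (f1 t * area_form (\<gamma> t) (N t)
        - f t * \<kappa> t * area_form (\<gamma> t) (T t) - f t) / 2"
      by (simp add: dB field_simps)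
    ultimately show ?thesis
      by (simp add: a0_def a2_def add_divide_distrib)
  qed
  have area: "enclosed_area L (\<lambda>t. normal_var f (e, t)) =
      integral {0..L} a0 + e * (- integral {0..L} f) + e\<^sup>2 * integral {0..L} a2" for e
  proof -
    have "((\<lambda>t. a0 t + e * (deriv B t - f t) + e\<^sup>2 * a2 t) has_integral
        integral {0..L} a0 + e * (integral {0..L} (deriv B) - integral {0..L} f)
          + e\<^sup>2 * integral {0..L} a2) {0..L}"
      by (intro has_integral_add has_integral_mult_right has_integral_diff
          integrable_integral A_integrable A f)
    then show ?thesis
      unfolding enclosed_area_def integrand by (simp add: integral_unique A_integral_deriv A)
  qed
  show ?thesis
    unfolding area by (auto intro!: derivative_eq_intros)
qed

section \<open>From a critical point to constant curvature\<close>

lemma A_eq_0I: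
  assumes "f \<in> A" "\<And>t. f t \<ge> 0" "integral {0..L} f = 0"
  shows "f t = 0"
proof -
  have "\<forall>t\<in>{0..L}. f t = 0"
    using assms(2,3) L_pos by (subst integral_eq_0_iff[symmetric]) (auto intro: A_continuous assms(1))
  moreover obtain s where s: "0 \<le> s" "s < 0 + L"
      "\<And>h :: real \<Rightarrow> real. (\<And>t. h (t + L) = h t) \<Longrightarrow> h t = h s"
    using periodic_representative[OF L_pos] by metis
  ultimately have "f s = 0"
    by simp
  then show ?thesis
    using s(3)[of f] A_periodic[OF assms(1)] by simp
qed

lemma Euler_Lagrange:
  assumes crit: "critical_point_under total_sqrt_curv G \<gamma> L"
    and g: "g \<in> A"
    and G: "\<And>f. f \<in> A \<Longrightarrow> ((\<lambda>e. G L (\<lambda>t. normal_var f (e, t))) has_real_derivative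
        a * integral {0..L} (\<lambda>t. f t * g t)) (at 0)"
  shows "\<exists>c. \<forall>t. deriv (deriv (deriv (deriv p))) t + \<kappa> t * deriv (deriv p) t = c * g t"
proof -
  define h where "h t = deriv (deriv (deriv (deriv p))) t + \<kappa> t * deriv (deriv p) t" for t
  have h: "h \<in> A"
    unfolding h_def[abs_def] by (intro A.intros \<kappa>_A) (simp_all add: A_deriv A.p)
  obtain lam where lam: "\<And>\<Gamma>. admissible_variation \<Gamma> \<gamma> L \<Longrightarrow>
      deriv (\<lambda>e. total_sqrt_curv L (\<Gamma> e)) 0 = lam * deriv (\<lambda>e. G L (\<Gamma> e)) 0"
    using crit by (auto simp: critical_point_under_def)
  \<comment> \<open>The residual of the Euler-Lagrange equation serves as its own test function. The
    factor 6 clears the 1/6 in \<open>normal_variation_sqrt_curv\<close>.\<close>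
  let ?E = "\<lambda>t. h t - (6 * lam * a) * g t"
  have E: "?E \<in> A"
    by (intro A_diff A.mult A.const h g)
  have "integral {0..L} (\<lambda>t. f t * h t) / 6 = lam * (a * integral {0..L} (\<lambda>t. f t * g t))" if f: "f \<in> A" for f
    using lam[OF admissible_normal_var[OF f]]
    unfolding DERIV_imp_deriv[OF normal_variation_sqrt_curv[OF f]] DERIV_imp_deriv[OF G[OF f]] h_def .
  note crit_E = this[OF E]
  have scale: "I / 6 = lam * (a * J) \<Longrightarrow> I = (6 * lam * a) * J" for I J :: real
    by simp
  note eq = scale[OF crit_E]
  have "((\<lambda>t. ?E t * h t - (6 * lam * a) * (?E t * g t)) has_integral
      integral {0..L} (\<lambda>t. ?E t * h t) - (6 * lam * a) * integral {0..L} (\<lambda>t. ?E t * g t)) {0..L}"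
    by (intro has_integral_diff has_integral_mult_right integrable_integral A_integrable A.mult E h g)
  moreover have "(\<lambda>t. ?E t * h t - (6 * lam * a) * (?E t * g t)) = (\<lambda>t. ?E t * ?E t)"
    by (simp add: algebra_simps)
  ultimately have "((\<lambda>t. ?E t * ?E t) has_integral 0) {0..L}"
    unfolding eq by (simp only: diff_self)
  then have "integral {0..L} (\<lambda>t. ?E t * ?E t) = 0"
    by (rule integral_unique)
  then have "?E t * ?E t = 0" for t
    by (intro A_eq_0I[OF A.mult[OF E E]] zero_le_square)
  then have "h t = (6 * lam * a) * g t" for t
    by (metis mult_eq_0_iff right_minus_eq)
  then show ?thesis
    unfolding h_def by blast
qed

text \<open>The components of T span the solutions of \<open>w'' = - \<kappa> w\<close>, and T integrates to zero
  over the closed curve.\<close>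

lemma integral_solution_eq_0:
  assumes w: "w \<in> A" "\<And>t. deriv (deriv w) t = - \<kappa> t * w t"
  shows "integral {0..L} w = 0"
proof -
  \<comment> \<open>A conserved vector: its derivative vanishes by N' = - \<kappa> T and
    \<open>w'' = - \<kappa> w\<close>. Pairing it with T returns \<open>w\<close>, which therefore
    has the periodic primitive |\<gamma>, a|.\<close>
  let ?a = "\<lambda>t. w t *\<^sub>R N t - deriv w t *\<^sub>R T t"
  have "(?a has_vector_derivative
      (w t *\<^sub>R (- \<kappa> t *\<^sub>R T t) + deriv w t *\<^sub>R N t) - (deriv w t *\<^sub>R N t + (- \<kappa> t * w t) *\<^sub>R T t)) (at t)" for t
    using A_has_deriv[of "deriv w" t] w
    by (intro has_vector_derivative_diff has_vector_derivative_scaleR dT dN A_has_deriv w)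
      (simp add: A_deriv)
  then have "(?a has_vector_derivative 0) (at t)" for t
    by (simp add: algebra_simps)
  then obtain a where a: "\<And>t. ?a t = a"
    using has_vector_derivative_zero_constant[of UNIV ?a] by auto
  have w_eq: "w t = area_form (T t) a" for t
    unfolding a[of t, symmetric] by (simp add: area_form_simps TN)
  let ?g = "\<lambda>t. area_form (\<gamma> t) a"
  have "deriv ?g = w"
    by (rule ext, rule DERIV_imp_deriv) (auto intro!: derivative_eq_intros d\<gamma> simp: w_eq area_form_simps)
  moreover have "?g \<in> A"
    unfolding area_form_def using A.fst_vd[of 0] A.snd_vd[of 0]
    by (intro A_diff A.mult A.const) simp_all
  ultimately show ?thesis
    using A_integral_deriv[of ?g] by simp
qed

lemma curvature_constant:
  assumes h: "h \<in> A" "integral {0..L} h \<noteq> 0"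
    and g: "\<And>t. deriv (deriv h) t + \<kappa> t * h t = g t"
    and EL: "\<And>t. deriv (deriv (deriv (deriv p))) t + \<kappa> t * deriv (deriv p) t = c * g t"
  shows "\<kappa> t = \<kappa> 0"
proof -
  define p1 p2 p3 p4 where ps: "p1 = deriv p" "p2 = deriv (deriv p)" "p3 = deriv (deriv (deriv p))"
    "p4 = deriv (deriv (deriv (deriv p)))"
  have p_A: "p1 \<in> A" "p2 \<in> A" "p3 \<in> A" "p4 \<in> A"
    unfolding ps by (simp_all add: A_deriv A.p)
  have d: "(p has_real_derivative p1 t) (at t)" "(p1 has_real_derivative p2 t) (at t)"
    "(p2 has_real_derivative p3 t) (at t)" "(p3 has_real_derivative p4 t) (at t)" for t
    unfolding ps by (simp_all add: A_deriv A.p)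
  let ?w = "\<lambda>t. p2 t - c * h t"
  have w: "?w \<in> A"
    by (intro A_diff A.mult A.const p_A h)
  have dh: "(h has_real_derivative deriv h t) (at t)" "(deriv h has_real_derivative deriv (deriv h) t) (at t)" for t
    using h by (simp_all add: A_deriv)
  have "deriv ?w = (\<lambda>t. p3 t - c * deriv h t)"
    by (rule ext, rule DERIV_imp_deriv) (auto intro!: derivative_eq_intros d dh)
  moreover have "deriv (\<lambda>t. p3 t - c * deriv h t) t = p4 t - c * deriv (deriv h) t" for t
    by (rule DERIV_imp_deriv) (auto intro!: derivative_eq_intros d dh)
  moreover have "p4 t - c * deriv (deriv h) t = - \<kappa> t * ?w t" for t
    using EL[of t] g[of t, symmetric] unfolding ps by (simp add: algebra_simps)
  ultimately have "integral {0..L} ?w = 0"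
    by (intro integral_solution_eq_0 w) simp
  moreover have "(?w has_integral integral {0..L} p2 - c * integral {0..L} h) {0..L}"
    by (intro has_integral_diff has_integral_mult_right integrable_integral A_integrable p_A h)
  moreover have "integral {0..L} p2 = 0"
    using A_integral_deriv[OF p_A(1)] by (simp add: ps)
  ultimately have "c = 0"
    using h by (simp add: integral_unique)
  then have EL0: "(p t)\<^sup>2 * p4 t + p2 t = 0" for t
    using EL[of t] p_pos[of t] unfolding ps by (simp add: \<kappa>_p field_simps)
  \<comment> \<open>Differentiating the first term gives \<open>p^2 p''''\<close> and
    \<open>2 p p' p'''\<close>. The second term cancels the latter but adds
    \<open>- 2 p'^2 p''\<close>, which the cube cancels. Besides the equation only
    \<open>- 2 p p''^2\<close> survives, and it has one sign.\<close>
  define B where "B t = (p t)\<^sup>2 * p3 t - 2 * p t * p1 t * p2 t + 2/3 * p1 t ^ 3 + p1 t" for t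
  have B: "B \<in> A"
    unfolding B_def[abs_def] by (intro A.add A_diff A.mult A_power A.const A.p p_A)
  have "(B has_real_derivative ((p t)\<^sup>2 * p4 t + p2 t) - 2 * p t * (p2 t)\<^sup>2) (at t)" for t
    unfolding B_def[abs_def]
    by (rule derivative_eq_intros d refl)+ (simp add: power2_eq_square algebra_simps)
  then have "deriv B t = ((p t)\<^sup>2 * p4 t + p2 t) - 2 * p t * (p2 t)\<^sup>2" for t
    by (rule DERIV_imp_deriv)
  then have dB: "deriv B = (\<lambda>t. (- 2) * (p t * (p2 t)\<^sup>2))"
    unfolding EL0 by (simp add: fun_eq_iff)
  have "integral {0..L} (\<lambda>t. p t * (p2 t)\<^sup>2) = 0"
    using A_integral_deriv[OF B] by (simp add: dB)
  moreover have "(\<lambda>t. p t * (p2 t)\<^sup>2) \<in> A"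
    by (intro A.mult A_power p_A A.p)
  ultimately have "p t * (p2 t)\<^sup>2 = 0" for t
    using A_eq_0I[of "\<lambda>t. p t * (p2 t)\<^sup>2" t] less_imp_le[OF p_pos] by simp
  then have p2: "p2 t = 0" for t
    using p_pos[of t] by (metis less_irrefl mult_eq_0_iff power_eq_0_iff)
  then have p1: "p1 t = p1 0" for t
    using d(2) by (intro DERIV_isconst_all allI) metis
  have "integral {0..L} p1 = integral {0..L} (\<lambda>_. p1 0)"
    using p1 by (rule integral_cong)
  moreover have "integral {0..L} p1 = 0"
    using A_integral_deriv[OF A.p] by (simp only: ps)
  ultimately have "p1 0 = 0"
    using L_pos by simp
  then have "p t = p 0"
    using d(1) p1 by (intro DERIV_isconst_all allI) metis
  then show ?thesis
    by (simp add: \<kappa>_p)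
qed

lemma critical_affine_length_imp_constant:
  assumes "critical_point_under total_sqrt_curv affine_length \<gamma> L"
  shows "\<kappa> t = \<kappa> 0"
proof -
  obtain c where c: "\<And>t. deriv (deriv (deriv (deriv p))) t + \<kappa> t * deriv (deriv p) t = c * \<kappa> t"
    using Euler_Lagrange[OF assms \<kappa>_A normal_variation_affine_length] by blast
  show ?thesis
    by (rule curvature_constant[OF A.const[of 1] _ _ c]) (use L_pos in simp_all)
qed

lemma critical_total_curv_imp_constant:
  assumes "critical_point_under total_sqrt_curv total_curv \<gamma> L"
  shows "\<kappa> t = \<kappa> 0"
proof -
  have "(\<lambda>t. deriv (deriv \<kappa>) t + (\<kappa> t)\<^sup>2) \<in> A"
    by (intro A.intros A_power \<kappa>_A) (simp add: A_deriv \<kappa>_A)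
  then obtain c where c: "\<And>t. deriv (deriv (deriv (deriv p))) t + \<kappa> t * deriv (deriv p) t
      = c * (deriv (deriv \<kappa>) t + (\<kappa> t)\<^sup>2)"
    using Euler_Lagrange[OF assms _ normal_variation_total_curv] by blast
  have "integral {0..L} \<kappa> \<noteq> 0"
    using A_eq_0I[OF \<kappa>_A] curv_pos by (metis less_irrefl less_imp_le)
  then show ?thesis
    by (rule curvature_constant[OF \<kappa>_A _ _ c]) (simp add: power2_eq_square)
qed

text \<open>This is where simplicity of the curve enters: it is what will make the integral in
  \<open>pos\<close> nonzero.\<close>

lemma critical_area_imp_constant:
  assumes "critical_point_under total_sqrt_curv enclosed_area \<gamma> L"
    and pos: "integral {0..L} (\<lambda>t. area_form (\<gamma> t - \<gamma> s) (T t)) \<noteq> 0"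
  shows "\<kappa> t = \<kappa> 0"
proof -
  obtain c where c: "\<And>t. deriv (deriv (deriv (deriv p))) t + \<kappa> t * deriv (deriv p) t = c * 1"
    using Euler_Lagrange[OF assms(1) A.const[of 1], of "-1"] normal_variation_area by auto
  let ?h = "\<lambda>t. area_form (\<gamma> t - \<gamma> s) (T t)"
  have "?h \<in> A"
    unfolding area_form_def fst_diff snd_diff
    using A.fst_vd[of 0] A.snd_vd[of 0] A.fst_vd[of 1] A.snd_vd[of 1]
    by (intro A_diff A.mult A.const) simp_all
  moreover have "deriv ?h = (\<lambda>t. area_form (\<gamma> t - \<gamma> s) (N t))"
    by (rule ext, rule DERIV_imp_deriv) (auto intro!: derivative_eq_intros d\<gamma> dT simp: area_form_simps)
  moreover have "deriv (\<lambda>t. area_form (\<gamma> t - \<gamma> s) (N t)) t = 1 - \<kappa> t * ?h t" for t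
    by (rule DERIV_imp_deriv) (auto intro!: derivative_eq_intros d\<gamma> dN simp: area_form_simps TN algebra_simps)
  ultimately show ?thesis
    by (intro curvature_constant[OF _ pos _ c]) simp_all
qed

end

section \<open>The tangent of a simple closed curve turns once\<close>

text \<open>The sine of the angle gained stays nonnegative, so the angle cannot reach - pi/2 or 3
  pi/2, where the sine is -1. Between these values, zero sine and negative cosine leave only
  pi.\<close>

lemma arg_half_turn:
  fixes g :: "real \<Rightarrow> complex"
  assumes "a \<le> b" and g: "continuous_on {a..b} g"
    and upper: "\<And>t. t \<in> {a..b} \<Longrightarrow> Im (exp (g t)) \<ge> 0"
    and a: "Im (exp (g a)) = 0" "Re (exp (g a)) > 0"
    and b: "Im (exp (g b)) = 0" "Re (exp (g b)) < 0"
  shows "Im (g b) = Im (g a) + pi"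
proof -
  define \<phi> where "\<phi> t = Im (g t) - Im (g a)" for t
  have cont: "continuous_on {a..b} \<phi>"
    unfolding \<phi>_def by (intro continuous_intros g)
  have sin_a: "sin (Im (g a)) = 0" and cos_a: "cos (Im (g a)) > 0"
    using a by (simp_all add: Im_exp Re_exp zero_less_mult_iff)
  have cos_a1: "cos (Im (g a)) = 1"
  proof -
    have "(cos (Im (g a)))\<^sup>2 = 1"
      using sin_cos_squared_add[of "Im (g a)"] unfolding sin_a by simp
    then show ?thesis
      using cos_a unfolding power2_eq_1_iff by auto
  qed
  have sin: "sin (\<phi> t) \<ge> 0" if "t \<in> {a..b}" for t
    using upper[OF that] by (simp add: \<phi>_def sin_diff sin_a cos_a1 Im_exp zero_le_mult_iff)
  have sin_b: "sin (\<phi> b) = 0" and cos_b: "cos (\<phi> b) < 0"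
    using b by (simp_all add: \<phi>_def sin_diff cos_diff sin_a cos_a1 Im_exp Re_exp mult_less_0_iff)
  have "\<phi> a = 0"
    by (simp add: \<phi>_def)
  have lower: "\<phi> b > - (pi/2)"
  proof (rule ccontr)
    assume "\<not> \<phi> b > - (pi/2)"
    then obtain t where "a \<le> t" "t \<le> b" "\<phi> t = - (pi/2)"
      using IVT2'[of \<phi> b "- (pi/2)" a] \<open>\<phi> a = 0\<close> \<open>a \<le> b\<close> cont by auto
    then show False
      using sin[of t] by simp
  qed
  have upper: "\<phi> b < 3 * pi / 2"
  proof (rule ccontr)
    assume "\<not> \<phi> b < 3 * pi / 2"
    then obtain t where t: "a \<le> t" "t \<le> b" "\<phi> t = 3 * pi / 2"
      using IVT'[of \<phi> a "3 * pi / 2" b] \<open>\<phi> a = 0\<close> \<open>a \<le> b\<close> cont by auto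
    then have "\<phi> t = 2 * pi - pi / 2"
      by linarith
    moreover have "sin (2 * pi - pi / 2) = - 1"
      unfolding sin_diff by simp
    ultimately have "sin (\<phi> t) = - 1"
      by (simp only:)
    then show False
      using sin[of t] t by simp
  qed
  have "\<phi> b \<ge> pi / 2"
  proof (rule ccontr)
    assume "\<not> \<phi> b \<ge> pi / 2"
    then have "\<phi> b < pi / 2"
      by (rule not_le_imp_less)
    with lower have "cos (\<phi> b) > 0"
      by (rule cos_gt_zero_pi)
    with cos_b show False
      by (rule less_asym)
  qed
  then have "- pi < \<phi> b - pi" "\<phi> b - pi < pi"
    using upper pi_gt_zero by linarith+
  moreover have "sin (\<phi> b - pi) = 0"
    using sin_b by (simp add: sin_diff)
  ultimately have "\<phi> b - pi = 0"
    by (rule sin_eq_0_pi)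
  then show ?thesis
    by (simp add: \<phi>_def)
qed

text \<open>Hopf's argument. The secant \<open>z t - z s\<close>, suitably rescaled, extends to a continuous
  function D without zeros on the strip \<open>s \<le> t \<le> s + L\<close>, equal to the tangent on the edge \<open>s = t\<close>
  and to its opposite on the edge \<open>t = s + L\<close>. So the rotation of the tangent can be measured along
  the other two sides of the triangle with a lowest point of the curve as its corner, where D stays
  in a half plane.\<close>

theorem tangent_rotation:
  fixes z z' :: "real \<Rightarrow> complex"
  assumes "L > 0"
    and dz: "\<And>t. (z has_vector_derivative z' t) (at t)"
    and contz': "continuous_on UNIV z'" and nz: "\<And>t. z' t \<noteq> 0"
    and per: "\<And>t. z (t + L) = z t" and inj: "inj_on z {0..<L}"
    and low: "\<And>t. Im (z s0) \<le> Im (z t)" and tangent: "Im (z' s0) = 0" "Re (z' s0) > 0"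
  shows "\<exists>g. continuous_on {s0..s0 + L} g \<and> (\<forall>t\<in>{s0..s0 + L}. exp (g t) = z' t)
    \<and> Im (g (s0 + L)) = Im (g s0) + 2 * pi"
proof -
  have per': "z' (t + L) = z' t" for t
    by (rule periodic_derivative[OF dz per])
  have z_eq: "\<exists>n::int. t - s = of_int n * L" if "z s = z t" for s t
  \<comment> \<open>Injectivity on one period identifies the reductions of \<open>s\<close> and
    \<open>t\<close> modulo \<open>L\<close>.\<close>
  proof -
    define n m where "n = \<lfloor>s / L\<rfloor>" and "m = \<lfloor>t / L\<rfloor>"
    have rep: "x - of_int \<lfloor>x / L\<rfloor> * L \<in> {0..<L}" for x
    proof -
      have "of_int \<lfloor>x / L\<rfloor> \<le> x / L" "x / L < of_int \<lfloor>x / L\<rfloor> + 1"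
        by linarith+
      then have "of_int \<lfloor>x / L\<rfloor> * L \<le> x" "x < (of_int \<lfloor>x / L\<rfloor> + 1) * L"
        by (simp_all only: pos_le_divide_eq[OF \<open>L > 0\<close>] pos_divide_less_eq[OF \<open>L > 0\<close>])
      then show ?thesis
        by (simp add: algebra_simps)
    qed
    have z_rep: "z (x - of_int k * L) = z x" for x k
      using periodic_int_shift[of z L x "- k", OF per] by simp
    have "s - of_int n * L = t - of_int m * L"
      using inj_onD[OF inj _ rep rep, of s t] that by (simp add: z_rep n_def m_def)
    then show ?thesis
      by (intro exI[of _ "m - n"]) (simp add: algebra_simps)
  qed
  have z_neq: "z s \<noteq> z t" if "s < t" "t < s + L" for s t
  proof
    assume "z s = z t"
    then obtain n :: int where n: "t - s = of_int n * L"
      using z_eq by blast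
    have "0 < of_int n * L" "of_int n * L < 1 * L"
      using that n by linarith+
    then have "0 < n" "n < 1"
      using \<open>L > 0\<close> by (simp_all only: zero_less_mult_iff mult_less_cancel_right) auto
    then show False
      by simp
  qed
  \<comment> \<open>The mean of the tangent between \<open>a\<close> and \<open>b\<close>: the
    difference quotient of \<open>z\<close> in a form that is continuous across
    \<open>a = b\<close>.\<close>
  define q where "q a b = integral {0..1} (\<lambda>u. z' (a + u * (b - a)))" for a b
  have q: "(b - a) *\<^sub>R q a b = z b - z a" for a b
  proof -
    have "((\<lambda>u. (b - a) *\<^sub>R z' (a + u * (b - a))) has_integral z (a + 1 * (b - a)) - z (a + 0 * (b - a))) {0..1}"
    proof (rule fundamental_theorem_of_calculus)
      fix u :: real
      have "((\<lambda>u. a + u * (b - a)) has_vector_derivative b - a) (at u)"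
        by (auto intro!: derivative_eq_intros)
      from vector_diff_chain_at[OF this dz, unfolded o_def]
      show "((\<lambda>u. z (a + u * (b - a))) has_vector_derivative (b - a) *\<^sub>R z' (a + u * (b - a))) (at u within {0..1})"
        by (rule has_vector_derivative_at_within)
    qed simp
    from integral_unique[OF this] show ?thesis
      unfolding q_def integral_cmul by simp
  qed
  have contq: "continuous_on UNIV (\<lambda>p. q (fst p) (snd p))"
  proof -
    have "continuous_on (UNIV \<times> cbox 0 1) (\<lambda>x :: (real \<times> real) \<times> real.
        z' (fst (fst x) + snd x * (snd (fst x) - fst (fst x))))"
      by (rule continuous_on_compose2[OF contz']) (intro continuous_intros subset_UNIV)+
    then have "continuous_on (UNIV \<times> cbox 0 1) (\<lambda>(p :: real \<times> real, u). z' (fst p + u * (snd p - fst p)))"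
      by (simp only: case_prod_unfold)
    from integral_continuous_on_param[OF this]
    show ?thesis
      by (simp only: q_def box_real)
  qed
  have q_diag: "q t t = z' t" for t
    by (simp add: q_def)
  \<comment> \<open>On the edge \<open>s = t\<close> the first quotient is the tangent and the
    second is zero; on \<open>t = s + L\<close> the roles are exchanged, up to sign. In between,
    \<open>D\<close> is a positive multiple of the secant, nonzero by injectivity.\<close>
  define D where "D p = q (fst p) (snd p) - q (snd p - L) (fst p)" for p
  define S where "S = {p :: real \<times> real. fst p \<le> snd p \<and> snd p \<le> fst p + L}"
  have D_inside: "D (s, t) = (1 / (t - s) + 1 / (s + L - t)) *\<^sub>R (z t - z s)" if "s < t" "t < s + L" for s t
  proof -
    have "q s t = (1 / (t - s)) *\<^sub>R (z t - z s)"
      unfolding q[symmetric] using that by simp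
    moreover have "z s - z t = (s + L - t) *\<^sub>R q (t - L) s"
      using q[of s "t - L"] per[of "t - L"] by (simp add: algebra_simps)
    then have "(1 / (s + L - t)) *\<^sub>R (z s - z t) = q (t - L) s"
      using that by simp
    ultimately have "D (s, t) = (1 / (t - s)) *\<^sub>R (z t - z s) - (1 / (s + L - t)) *\<^sub>R (z s - z t)"
      by (simp add: D_def)
    then show ?thesis
      by (simp only: scaleR_add_left scaleR_diff_right) simp
  qed
  have D_left: "D (t, t) = z' t" for t
    using q[of t "t - L"] per[of "t - L"] \<open>L > 0\<close> by (simp add: D_def q_diag)
  have D_right: "D (s, s + L) = - z' s" for s
    using q[of "s + L" s] per[of s] \<open>L > 0\<close> by (simp add: D_def q_diag)
  have D_nz: "D p \<noteq> 0" if p_S: "p \<in> S" for p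
  proof -
    obtain s t where p: "p = (s, t)" by force
    consider "t = s" | "t = s + L" | "s < t" "t < s + L"
      using p_S unfolding S_def p by (simp add: le_less) blast
    then show ?thesis
    proof cases
      case 3
      then have "1 / (t - s) + 1 / (s + L - t) > 0"
        by (intro add_pos_pos) auto
      then show ?thesis
        using z_neq[OF 3] by (simp add: p D_inside[OF 3])
    qed (simp_all add: p D_left D_right nz)
  qed
  have contD: "continuous_on S D"
    unfolding D_def
    by (intro continuous_intros continuous_on_compose2[OF contq, of _ "\<lambda>p. (snd p - L, fst p)", simplified]
        continuous_on_subset[OF contq]) auto
  have "S = {p. (1, - 1) \<bullet> p \<le> 0} \<inter> {p. (- 1, 1) \<bullet> p \<le> L}"
    by (auto simp: S_def)
  then have "convex S"
    by (simp only: convex_Int convex_halfspace_le)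
  \<comment> \<open>Convexity makes \<open>S\<close> contractible, so \<open>D\<close> has a
    continuous logarithm, whose imaginary part measures the rotation.\<close>
  then obtain g where contg: "continuous_on S g" and g: "\<And>p. p \<in> S \<Longrightarrow> D p = exp (g p)"
    using continuous_logarithm_on_contractible[OF contD convex_imp_contractible D_nz] by blast
  have half1: "Im (g (s0, s0 + L)) = Im (g (s0, s0)) + pi"
  proof (rule arg_half_turn[where g = "\<lambda>t. g (s0, t)"])
    show "continuous_on {s0..s0 + L} (\<lambda>t. g (s0, t))"
      by (rule continuous_on_compose2[OF contg]) (auto intro!: continuous_intros simp: S_def)
    show "0 \<le> Im (exp (g (s0, t)))" if t: "t \<in> {s0..s0 + L}" for t
    proof -
      consider "t = s0" | "t = s0 + L" | "s0 < t" "t < s0 + L"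
        using t by (simp add: le_less) blast
      then have "0 \<le> Im (D (s0, t))"
        using low[of t] by cases (simp_all add: D_left D_right D_inside tangent)
      then show ?thesis
        using g[of "(s0, t)"] t by (simp add: S_def)
    qed
  qed (use \<open>L > 0\<close> tangent g[of "(s0, s0)", symmetric] g[of "(s0, s0 + L)", symmetric] in \<open>simp_all add: S_def D_left D_right\<close>)
  \<comment> \<open>Secants ending at the lowest point have nonpositive imaginary part. Adding
    \<open>\<i> * pi\<close> to the logarithm negates \<open>D\<close>, so that
    \<open>arg_half_turn\<close> applies again.\<close>
  have half2: "Im (g (s0 + L, s0 + L) + \<i> * pi) = Im (g (s0, s0 + L) + \<i> * pi) + pi"
  proof (rule arg_half_turn[where g = "\<lambda>s. g (s, s0 + L) + \<i> * pi"])
    show "continuous_on {s0..s0 + L} (\<lambda>s. g (s, s0 + L) + \<i> * pi)"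
      by (intro continuous_intros continuous_on_compose2[OF contg]) (auto intro!: continuous_intros simp: S_def)
    show "0 \<le> Im (exp (g (s, s0 + L) + \<i> * pi))" if s: "s \<in> {s0..s0 + L}" for s
    proof -
      consider "s = s0" | "s = s0 + L" | "s0 < s" "s < s0 + L"
        using s by (simp add: le_less) blast
      then have "Im (D (s, s0 + L)) \<le> 0"
        using low[of s]
        by cases (simp_all add: D_left D_right D_inside tangent per per' mult_nonneg_nonpos)
      then show ?thesis
        using g[of "(s, s0 + L)"] s by (simp add: S_def exp_add)
    qed
  qed (use \<open>L > 0\<close> tangent g[of "(s0 + L, s0 + L)", symmetric] g[of "(s0, s0 + L)", symmetric] in
      \<open>simp_all add: S_def D_left D_right per' exp_add\<close>)
  show ?thesis
  proof (intro exI conjI ballI)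
    show "continuous_on {s0..s0 + L} (\<lambda>t. g (t, t))"
      using \<open>L > 0\<close> by (intro continuous_on_compose2[OF contg] continuous_intros) (auto simp: S_def)
    show "exp (g (t, t)) = z' t" for t
      using g[of "(t, t)"] \<open>L > 0\<close> by (simp add: S_def D_left)
    show "Im (g (s0 + L, s0 + L)) = Im (g (s0, s0)) + 2 * pi"
      using half1 half2 by simp
  qed
qed

section \<open>A simple closed curve encloses positive area\<close>

locale simple_unit_speed_curve = unit_speed_curve +
  assumes inj: "inj_on \<gamma> {0..<L}"
begin

lemma lowest_point: "\<exists>s0. \<forall>t. snd (\<gamma> s0) \<le> snd (\<gamma> t)"
proof -
  have "continuous_on {0..L} (\<lambda>t. snd (\<gamma> t))"
    using A_continuous[OF A.snd_vd[of 0]] by simp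
  then obtain s0 where s0: "s0 \<in> {0..L}" "\<And>t. t \<in> {0..L} \<Longrightarrow> snd (\<gamma> s0) \<le> snd (\<gamma> t)"
    using continuous_attains_inf[of "{0..L}" "\<lambda>t. snd (\<gamma> t)"] L_pos by auto
  have "snd (\<gamma> s0) \<le> snd (\<gamma> t)" for t
  proof -
    obtain s where s: "0 \<le> s" "s < 0 + L"
        "\<And>h :: real \<Rightarrow> real \<times> real. (\<And>t. h (t + L) = h t) \<Longrightarrow> h t = h s"
      using periodic_representative[OF L_pos] by metis
    have "\<gamma> t = \<gamma> s"
      using s(3)[of \<gamma>] periodic by (simp add: periodic_curve_def)
    then show ?thesis
      using s0(2)[of s] s by simp
  qed
  then show ?thesis
    by blast
qed

text \<open>Minimality makes T horizontal, and then |T, N| = 1 makes \<open>fst T\<close> and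
  \<open>snd N\<close> reciprocal. A leftward tangent would give the height a negative second
  derivative, hence a descent just after \<open>s0\<close>.\<close>

lemma tangent_at_lowest_point:
  assumes low: "\<And>t. snd (\<gamma> s0) \<le> snd (\<gamma> t)"
  shows "snd (T s0) = 0" "fst (T s0) > 0"
proof -
  have dy: "((\<lambda>t. snd (\<gamma> t)) has_real_derivative snd (T t)) (at t)"
    and dy': "((\<lambda>t. snd (T t)) has_real_derivative snd (N t)) (at t)" for t
    using bounded_linear.has_vector_derivative[OF bounded_linear_snd d\<gamma>]
      bounded_linear.has_vector_derivative[OF bounded_linear_snd dT]
    by (simp_all add: has_real_derivative_iff_has_vector_derivative)
  show T0: "snd (T s0) = 0"
    by (rule DERIV_local_min[OF dy, of 1]) (use low in auto)
  have TN0: "fst (T s0) * snd (N s0) = 1"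
    using TN[of s0] T0 by (simp add: area_form_def)
  show "fst (T s0) > 0"
  proof (rule ccontr)
    assume "\<not> fst (T s0) > 0"
    then have "snd (N s0) < 0"
      using TN0 zero_less_mult_iff[of "fst (T s0)" "snd (N s0)"] by simp
    then obtain d where d: "d > 0" "\<And>h. 0 < h \<Longrightarrow> h < d \<Longrightarrow> snd (T (s0 + h)) < snd (T s0)"
      using DERIV_neg_dec_right[OF dy'] by blast
    have "snd (\<gamma> (s0 + d)) < snd (\<gamma> s0)"
    proof (rule DERIV_neg_imp_decreasing_open[where f = "\<lambda>t. snd (\<gamma> t)" and a = s0 and b = "s0 + d"])
      fix x assume "s0 < x" "x < s0 + d"
      then have "snd (T x) < 0"
        using d(2)[of "x - s0"] T0 by simp
      then show "\<exists>y. ((\<lambda>t. snd (\<gamma> t)) has_real_derivative y) (at x) \<and> y < 0"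
        using dy by blast
    qed (use d A_continuous[OF A.snd_vd[of 0]] in simp_all)
    then show False
      using low[of "s0 + d"] by simp
  qed
qed

lemma tangent_angle:
  assumes low: "\<And>t. snd (\<gamma> s0) \<le> snd (\<gamma> t)"
  shows "\<exists>\<theta> \<rho>. continuous_on {s0..s0 + L} \<theta> \<and> \<theta> (s0 + L) = \<theta> s0 + 2 * pi \<and>
    (\<forall>t\<in>{s0..s0 + L}. \<rho> t > 0 \<and> T t = (\<rho> t * cos (\<theta> t), \<rho> t * sin (\<theta> t)))"
proof -
  let ?z = "\<lambda>t. Complex (fst (\<gamma> t)) (snd (\<gamma> t))" and ?z' = "\<lambda>t. Complex (fst (T t)) (snd (T t))"
  have "\<exists>g. continuous_on {s0..s0 + L} g \<and> (\<forall>t\<in>{s0..s0 + L}. exp (g t) = ?z' t)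
    \<and> Im (g (s0 + L)) = Im (g s0) + 2 * pi"
  proof (rule tangent_rotation[OF L_pos])
    show "(?z has_vector_derivative ?z' t) (at t)" for t
      using bounded_linear.has_vector_derivative[OF bounded_linear_fst d\<gamma>, of t]
        bounded_linear.has_vector_derivative[OF bounded_linear_snd d\<gamma>, of t]
      by (simp add: has_vector_derivative_complex_iff has_real_derivative_iff_has_vector_derivative)
    show "continuous_on UNIV ?z'"
      using A_continuous[OF A.fst_vd[of 1]] A_continuous[OF A.snd_vd[of 1]]
      by (simp add: continuous_on_Complex)
    show "?z' t \<noteq> 0" for t
      using TN[of t] by (auto simp: complex_eq_iff area_form_def)
    show "?z (t + L) = ?z t" for t
      using periodic by (simp add: periodic_curve_def)
    show "inj_on ?z {0..<L}"
      using inj by (simp add: inj_on_def prod_eq_iff)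
  qed (use low tangent_at_lowest_point[OF low] in simp_all)
  then obtain g where g: "continuous_on {s0..s0 + L} g" "\<And>t. t \<in> {s0..s0 + L} \<Longrightarrow> exp (g t) = ?z' t"
      "Im (g (s0 + L)) = Im (g s0) + 2 * pi"
    by blast
  show ?thesis
  proof (intro exI conjI ballI)
    show "continuous_on {s0..s0 + L} (\<lambda>t. Im (g t))"
      by (intro continuous_intros g)
    show "Im (g (s0 + L)) = Im (g s0) + 2 * pi"
      by (rule g)
    show "exp (Re (g t)) > 0" for t
      by simp
    show "T t = (exp (Re (g t)) * cos (Im (g t)), exp (Re (g t)) * sin (Im (g t)))"
      if "t \<in> {s0..s0 + L}" for t
      using g(2)[OF that] by (simp add: complex_eq_iff Re_exp Im_exp prod_eq_iff)
  qed
qed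

text \<open>The angle is nondecreasing and gains 2 pi in total. If it gains at most pi from
  \<open>s0\<close> to \<open>t\<close>, then |\<gamma> r, T t| does not decrease as
  \<open>r\<close> runs from \<open>s0\<close> to \<open>t\<close>. Otherwise less than pi remains,
  and it does not increase from \<open>t\<close> to \<open>s0 + L\<close>. Either way its value at
  \<open>r = t\<close> is at least its value at \<open>s0\<close>.\<close>

lemma support_nonneg:
  assumes low: "\<And>t. snd (\<gamma> s0) \<le> snd (\<gamma> t)"
  shows "area_form (\<gamma> t - \<gamma> s0) (T t) \<ge> 0"
proof -
  obtain \<theta> \<rho> where cont: "continuous_on {s0..s0 + L} \<theta>" and turn: "\<theta> (s0 + L) = \<theta> s0 + 2 * pi"
    and \<rho>: "\<And>t. t \<in> {s0..s0 + L} \<Longrightarrow> \<rho> t > 0"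
    and T: "\<And>t. t \<in> {s0..s0 + L} \<Longrightarrow> T t = (\<rho> t * cos (\<theta> t), \<rho> t * sin (\<theta> t))"
    using tangent_angle[OF low] by blast
  have area_TT: "area_form (T r) (T t) = \<rho> r * \<rho> t * sin (\<theta> t - \<theta> r)"
    if "r \<in> {s0..s0 + L}" "t \<in> {s0..s0 + L}" for r t
    using that by (simp add: T area_form_def sin_diff algebra_simps)
  have mono: "\<theta> a \<le> \<theta> b" if ab: "s0 \<le> a" "a \<le> b" "b \<le> s0 + L" for a b
  proof -
    have contab: "continuous_on {a..b} \<theta>"
      using ab by (intro continuous_on_subset[OF cont]) auto
    then obtain t where t: "t \<in> {a..b}" "\<And>r. r \<in> {a..b} \<Longrightarrow> \<theta> r \<le> \<theta> t"
      using continuous_attains_sup[of "{a..b}" \<theta>] ab by auto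
    \<comment> \<open>The curve turns left, so the angle cannot have a maximum before b.\<close>
    have "t = b"
    proof (rule ccontr)
      assume "t \<noteq> b"
      with t have "t < b"
        by simp
      have dTT: "((\<lambda>r. area_form (T t) (T r)) has_real_derivative 1) (at t)"
        using has_real_derivative_area_form[OF has_vector_derivative_const[of "T t"] dT, of t]
        by (simp add: TN area_form_simps)
      obtain d1 where d1: "d1 > 0"
          "\<And>h. 0 < h \<Longrightarrow> h < d1 \<Longrightarrow> area_form (T t) (T t) < area_form (T t) (T (t + h))"
        using DERIV_pos_inc_right[OF dTT zero_less_one] by blast
      obtain d2 where d2: "d2 > 0" "\<And>r. r \<in> {a..b} \<Longrightarrow> dist r t < d2 \<Longrightarrow> dist (\<theta> r) (\<theta> t) < pi"
        using contab t(1) pi_gt_zero unfolding continuous_on_iff by blast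
      define h where "h = min (min d1 d2) (b - t) / 2"
      have h: "0 < h" "h < d1" "h < d2" "t + h \<in> {a..b}"
        using d1(1) d2(1) \<open>t < b\<close> t(1) by (auto simp: h_def min_def field_simps)
      \<comment> \<open>Just after \<open>t\<close> the tangent has turned left, so this sine is
        positive; yet \<open>\<theta> t\<close> is a maximum and the change is below pi, which
        forces the opposite sign.\<close>
      have "sin (\<theta> (t + h) - \<theta> t) > 0"
      proof -
        have "0 < \<rho> t * \<rho> (t + h) * sin (\<theta> (t + h) - \<theta> t)"
          using d1(2)[OF h(1,2)] area_TT[of t "t + h"] t(1) h(4) ab by simp
        moreover have "\<rho> t * \<rho> (t + h) > 0"
          using \<rho>[of t] \<rho>[of "t + h"] t(1) h(4) ab by simp
        ultimately show ?thesis
          by (simp add: zero_less_mult_iff)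
      qed
      moreover have "\<theta> t - \<theta> (t + h) \<ge> 0" "\<theta> t - \<theta> (t + h) \<le> pi"
        using t(2)[OF h(4)] d2(2)[OF h(4)] h(1,3) by (auto simp: dist_real_def)
      then have "sin (\<theta> t - \<theta> (t + h)) \<ge> 0"
        by (rule sin_ge_zero)
      ultimately show False
        using sin_minus[of "\<theta> t - \<theta> (t + h)"] by simp
    qed
    then show ?thesis
      using t(2)[of a] ab by simp
  qed
  have area_TT_nonneg: "area_form (T r) (T t) \<ge> 0"
    if "s0 \<le> r" "r \<le> t" "t \<le> s0 + L" "\<theta> t - \<theta> r \<le> pi" for r t
    using that \<rho>[of r] \<rho>[of t] sin_ge_zero[of "\<theta> t - \<theta> r"] mono[of r t]
    by (subst area_TT) auto
  have dH: "((\<lambda>r. area_form (\<gamma> r) (T t)) has_real_derivative area_form (T r) (T t)) (at r)" for r t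
    using has_real_derivative_area_form[OF d\<gamma> has_vector_derivative_const[of "T t"], of r]
    by (simp add: area_form_simps)
  have one_period: "area_form (\<gamma> t - \<gamma> s0) (T t) \<ge> 0" if t: "s0 \<le> t" "t < s0 + L" for t
  proof (cases "\<theta> t - \<theta> s0 \<le> pi")
    case True
    have "area_form (\<gamma> s0) (T t) \<le> area_form (\<gamma> t) (T t)"
    proof (rule DERIV_nonneg_imp_nondecreasing[OF t(1), where f = "\<lambda>r. area_form (\<gamma> r) (T t)"])
      fix r assume r: "s0 \<le> r" "r \<le> t"
      then have "area_form (T r) (T t) \<ge> 0"
        using t True mono[of s0 r] by (intro area_TT_nonneg) auto
      then show "\<exists>y. ((\<lambda>r. area_form (\<gamma> r) (T t)) has_real_derivative y) (at r) \<and> 0 \<le> y"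
        using dH by blast
    qed
    then show ?thesis
      by (simp add: area_form_simps)
  next
    case False
    have "area_form (\<gamma> (s0 + L)) (T t) \<le> area_form (\<gamma> t) (T t)"
    proof (rule DERIV_nonpos_imp_nonincreasing[where a = t and b = "s0 + L" and f = "\<lambda>r. area_form (\<gamma> r) (T t)"])
      fix r assume r: "t \<le> r" "r \<le> s0 + L"
      then have "area_form (T t) (T r) \<ge> 0"
        using t False mono[of r "s0 + L"] turn by (intro area_TT_nonneg) auto
      then show "\<exists>y. ((\<lambda>r. area_form (\<gamma> r) (T t)) has_real_derivative y) (at r) \<and> y \<le> 0"
        using dH area_form_swap[of "T t" "T r"] by (intro exI[of _ "area_form (T r) (T t)"]) auto
    qed (use t in simp)
    moreover have "\<gamma> (s0 + L) = \<gamma> s0"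
      using periodic by (simp add: periodic_curve_def)
    ultimately show ?thesis
      by (simp add: area_form_simps)
  qed
  obtain s where s: "s0 \<le> s" "s < s0 + L"
      "\<And>h :: real \<Rightarrow> real. (\<And>t. h (t + L) = h t) \<Longrightarrow> h t = h s"
    using periodic_representative[OF L_pos] by metis
  have "area_form (\<gamma> t - \<gamma> s0) (T t) = area_form (\<gamma> s - \<gamma> s0) (T s)"
    using vd_periodic[of 0] vd_periodic[of 1] by (intro s(3)) simp
  then show ?thesis
    using one_period[OF s(1,2)] by simp
qed

text \<open>The support function based at the lowest point is nonnegative, so a zero integral would
  make it vanish identically, against \<open>h'' = 1 - \<kappa> h\<close>.\<close>

lemma support_integral_nonzero:
  "\<exists>s. integral {0..L} (\<lambda>t. area_form (\<gamma> t - \<gamma> s) (T t)) \<noteq> 0"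
proof -
  obtain s where s: "\<And>t. snd (\<gamma> s) \<le> snd (\<gamma> t)"
    using lowest_point by blast
  let ?h = "\<lambda>t. area_form (\<gamma> t - \<gamma> s) (T t)"
  have h: "?h \<in> A"
    unfolding area_form_def fst_diff snd_diff
    using A.fst_vd[of 0] A.snd_vd[of 0] A.fst_vd[of 1] A.snd_vd[of 1]
    by (intro A_diff A.mult A.const) simp_all
  have "integral {0..L} ?h \<noteq> 0"
  proof
    assume "integral {0..L} ?h = 0"
    then have h0: "?h t = 0" for t
      using A_eq_0I[OF h support_nonneg[OF s]] by blast
    have "(?h has_real_derivative area_form (\<gamma> t - \<gamma> s) (N t)) (at t)" for t
      by (auto intro!: derivative_eq_intros d\<gamma> dT simp: area_form_simps)
    then have "((\<lambda>_. 0) has_real_derivative area_form (\<gamma> t - \<gamma> s) (N t)) (at t)" for t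
      by (simp only: h0)
    then have h1: "area_form (\<gamma> t - \<gamma> s) (N t) = 0" for t
      by (rule DERIV_unique) (rule DERIV_const)
    have "((\<lambda>t. area_form (\<gamma> t - \<gamma> s) (N t)) has_real_derivative 1 - \<kappa> t * ?h t) (at t)" for t
      by (auto intro!: derivative_eq_intros d\<gamma> dN simp: area_form_simps TN algebra_simps)
    then have "((\<lambda>_. 0) has_real_derivative 1) (at 0)"
      by (simp only: h0 h1 mult_zero_right diff_0_right)
    then have "1 = (0 :: real)"
      by (rule DERIV_unique) (rule DERIV_const)
    then show False
      by simp
  qed
  then show ?thesis
    by blast
qed

end

section \<open>Ellipses and constant curvature\<close>

lemma is_ellipseI:
  assumes "area_form u v \<noteq> 0" and "\<omega> \<noteq> 0"
    and c: "\<And>t. c t = x + cos (\<omega> * t) *\<^sub>R u + sin (\<omega> * t) *\<^sub>R v"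
  shows "is_ellipse c"
  unfolding is_ellipse_def
proof (intro exI conjI)
  show "fst u * snd v - fst v * snd u \<noteq> 0"
    using assms(1) by (simp add: area_form_def mult.commute)
  let ?E = "\<lambda>\<theta>. (fst x + fst u * cos \<theta> + fst v * sin \<theta>, snd x + snd u * cos \<theta> + snd v * sin \<theta>)"
  have c_eq: "c t = ?E (\<omega> * t)" for t
    by (simp add: c prod_eq_iff mult.commute)
  have "?E \<theta> = c (\<theta> / \<omega>)" for \<theta>
    using \<open>\<omega> \<noteq> 0\<close> by (simp add: c_eq)
  then have "?E \<theta> \<in> range c" for \<theta>
    by (metis rangeI)
  then show "range c = {?E \<theta> | \<theta>. True}"
    using c_eq by blast
qed

context unit_speed_curve
begin

lemma is_ellipse_if_constant_curvature:
  assumes const: "\<And>t. \<kappa> t = \<kappa> 0"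
  shows "is_ellipse \<gamma>"
proof -
  define k \<omega> where "k = \<kappa> 0" and "\<omega> = sqrt k"
  have k: "k > 0" "\<And>t. \<kappa> t = k"
    using curv_pos const by (auto simp: k_def)
  then have \<omega>: "\<omega> > 0" "\<omega> * \<omega> = k"
    by (simp_all add: \<omega>_def)
  have dNk: "(N has_vector_derivative - k *\<^sub>R T t) (at t)" for t
    using dN by (simp add: k(2))
  \<comment> \<open>For constant curvature all affine normals meet in one point \<open>x\<close>,
    the centre of the ellipse.\<close>
  have "((\<lambda>t. \<gamma> t + (1 / k) *\<^sub>R N t) has_vector_derivative T t + (1 / k) *\<^sub>R (- k *\<^sub>R T t)) (at t)" for t
    by (intro has_vector_derivative_add d\<gamma> bounded_linear.has_vector_derivative[OF bounded_linear_scaleR_right] dNk)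
  then have "((\<lambda>t. \<gamma> t + (1 / k) *\<^sub>R N t) has_vector_derivative 0) (at t)" for t
    using k by simp
  then obtain x where x: "\<And>t. \<gamma> t + (1 / k) *\<^sub>R N t = x"
    using has_vector_derivative_zero_constant[of UNIV "\<lambda>t. \<gamma> t + (1 / k) *\<^sub>R N t"] by auto
  \<comment> \<open>The position relative to the centre is \<open>U = - N / k\<close>, with U' = T
    and T' = - \<omega>^2 U. Thus \<open>a\<close> and \<open>b\<close> are \<open>U\<close> and
    \<open>T / \<omega>\<close> rotated back by the angle \<open>\<omega> * t\<close>, which makes
    them constant.\<close>
  define a where "a t = cos (\<omega> * t) *\<^sub>R (- (1 / k)) *\<^sub>R N t - (sin (\<omega> * t) / \<omega>) *\<^sub>R T t" for t
  define b where "b t = sin (\<omega> * t) *\<^sub>R (- (1 / k)) *\<^sub>R N t + (cos (\<omega> * t) / \<omega>) *\<^sub>R T t" for t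
  have dcos: "((\<lambda>t. cos (\<omega> * t)) has_real_derivative - (\<omega> * sin (\<omega> * t))) (at t)"
    and dsin: "((\<lambda>t. sin (\<omega> * t)) has_real_derivative \<omega> * cos (\<omega> * t)) (at t)" for t
    by (auto intro!: derivative_eq_intros)
  have du: "((\<lambda>t. (- (1 / k)) *\<^sub>R N t) has_vector_derivative T t) (at t)" for t
    using bounded_linear.has_vector_derivative[OF bounded_linear_scaleR_right dNk, of "- (1 / k)" t] k by simp
  have N_eq: "N t = (- (\<omega> * \<omega>)) *\<^sub>R (- (1 / k)) *\<^sub>R N t" for t
    using k \<omega> by simp
  have "(a has_vector_derivative
      (cos (\<omega> * t) *\<^sub>R T t + (- (\<omega> * sin (\<omega> * t))) *\<^sub>R (- (1 / k)) *\<^sub>R N t)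
      - ((sin (\<omega> * t) / \<omega>) *\<^sub>R N t + (\<omega> * cos (\<omega> * t) / \<omega>) *\<^sub>R T t)) (at t)" for t
    unfolding a_def
    by (intro has_vector_derivative_diff has_vector_derivative_scaleR du dT dcos DERIV_cdivide dsin)
  moreover have "(cos (\<omega> * t) *\<^sub>R T t + (- (\<omega> * sin (\<omega> * t))) *\<^sub>R (- (1 / k)) *\<^sub>R N t)
      - ((sin (\<omega> * t) / \<omega>) *\<^sub>R N t + (\<omega> * cos (\<omega> * t) / \<omega>) *\<^sub>R T t) = 0" for t
    using \<omega> by (simp add: \<omega>(2)[symmetric])
  ultimately have "(a has_vector_derivative 0) (at t)" for t
    by simp
  then obtain u where u: "\<And>t. a t = u"
    using has_vector_derivative_zero_constant[of UNIV a] by auto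
  have "(b has_vector_derivative
      (sin (\<omega> * t) *\<^sub>R T t + (\<omega> * cos (\<omega> * t)) *\<^sub>R (- (1 / k)) *\<^sub>R N t)
      + ((cos (\<omega> * t) / \<omega>) *\<^sub>R N t + (- (\<omega> * sin (\<omega> * t)) / \<omega>) *\<^sub>R T t)) (at t)" for t
    unfolding b_def
    by (intro has_vector_derivative_add has_vector_derivative_scaleR du dT dcos DERIV_cdivide dsin)
  moreover have "(sin (\<omega> * t) *\<^sub>R T t + (\<omega> * cos (\<omega> * t)) *\<^sub>R (- (1 / k)) *\<^sub>R N t)
      + ((cos (\<omega> * t) / \<omega>) *\<^sub>R N t + (- (\<omega> * sin (\<omega> * t)) / \<omega>) *\<^sub>R T t) = 0" for t
    using \<omega> by (simp add: \<omega>(2)[symmetric])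
  ultimately have "(b has_vector_derivative 0) (at t)" for t
    by simp
  then obtain v where v: "\<And>t. b t = v"
    using has_vector_derivative_zero_constant[of UNIV b] by auto
  show ?thesis
  proof (rule is_ellipseI)
    have "u = - (1 / k) *\<^sub>R N 0" "v = (1 / \<omega>) *\<^sub>R T 0"
      using u[of 0] v[of 0] by (simp_all add: a_def b_def)
    then have "area_form u v = 1 / (k * \<omega>)"
      using NT[of 0] by (simp add: area_form_simps)
    then show "area_form u v \<noteq> 0"
      using k \<omega> by simp
    show "\<omega> \<noteq> 0"
      using \<omega> by simp
    show "\<gamma> t = x + cos (\<omega> * t) *\<^sub>R u + sin (\<omega> * t) *\<^sub>R v" for t
    proof -
      have "C *\<^sub>R (C *\<^sub>R U - (S / \<omega>) *\<^sub>R W) + S *\<^sub>R (S *\<^sub>R U + (C / \<omega>) *\<^sub>R W) = (C\<^sup>2 + S\<^sup>2) *\<^sub>R U"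
        for C S and U W :: "real \<times> real"
        by (simp add: algebra_simps power2_eq_square)
      from this[of "cos (\<omega> * t)" "(- (1 / k)) *\<^sub>R N t" "sin (\<omega> * t)" "T t"]
      have "cos (\<omega> * t) *\<^sub>R u + sin (\<omega> * t) *\<^sub>R v = (- (1 / k)) *\<^sub>R N t"
        unfolding u[of t, symmetric] v[of t, symmetric] a_def b_def by simp
      then show ?thesis
        using x[of t] by (simp add: algebra_simps)
    qed
  qed
qed

text \<open>Only the range is known to be an ellipse, so no continuous angle function is at hand.
  Differentiating the circle equation in suitable affine coordinates yields the angular velocity
  instead, and unit speed forces it to be constant.\<close>

lemma constant_curvature_if_is_ellipse:
  assumes "is_ellipse \<gamma>"
  shows "\<kappa> t = \<kappa> 0"
proof -
  obtain x0 y0 a b p q where D: "a * q - b * p \<noteq> 0"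
    and range: "range \<gamma> = {(x0 + a * cos \<theta> + b * sin \<theta>, y0 + p * cos \<theta> + q * sin \<theta>) | \<theta>. True}"
    using assms unfolding is_ellipse_def by blast
  let ?D = "a * q - b * p"
  \<comment> \<open>Affine coordinates taking the ellipse to the unit circle. The translation
    affects only the curve itself, hence the case \<open>i = 0\<close>.\<close>
  define X where "X i t = (q * fst ((vd ^^ i) \<gamma> t) - b * snd ((vd ^^ i) \<gamma> t)) / ?D
      - (if i = 0 then (q * x0 - b * y0) / ?D else 0)" for i t
  define Y where "Y i t = (a * snd ((vd ^^ i) \<gamma> t) - p * fst ((vd ^^ i) \<gamma> t)) / ?D
      - (if i = 0 then (a * y0 - p * x0) / ?D else 0)" for i t
  have d: "((\<lambda>t. fst ((vd ^^ i) \<gamma> t)) has_real_derivative fst ((vd ^^ Suc i) \<gamma> t)) (at t)"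
    "((\<lambda>t. snd ((vd ^^ i) \<gamma> t)) has_real_derivative snd ((vd ^^ Suc i) \<gamma> t)) (at t)" for i t
    using bounded_linear.has_vector_derivative[OF bounded_linear_fst smooth_curve_has_vd[OF smooth, of i t]]
      bounded_linear.has_vector_derivative[OF bounded_linear_snd smooth_curve_has_vd[OF smooth, of i t]]
    by (simp_all only: has_real_derivative_iff_has_vector_derivative)
  have dX: "(X i has_real_derivative X (Suc i) t) (at t)" and dY: "(Y i has_real_derivative Y (Suc i) t) (at t)" for i t
    unfolding X_def[abs_def] Y_def[abs_def]
    by (rule DERIV_cong, rule DERIV_diff, rule DERIV_cdivide, rule DERIV_diff, rule DERIV_cmult, rule d,
        rule DERIV_cmult, rule d, rule DERIV_const, simp del: funpow.simps)+
  have circle: "X 0 t * X 0 t + Y 0 t * Y 0 t = 1" for t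
  proof -
    have "\<gamma> t \<in> range \<gamma>"
      by simp
    then obtain \<theta> where "\<gamma> t = (x0 + a * cos \<theta> + b * sin \<theta>, y0 + p * cos \<theta> + q * sin \<theta>)"
      unfolding range by blast
    then have "X 0 t = (?D * cos \<theta>) / ?D" "Y 0 t = (?D * sin \<theta>) / ?D"
      by (simp_all add: X_def Y_def diff_divide_distrib[symmetric] algebra_simps)
    then show ?thesis
      using D sin_cos_squared_add2[of \<theta>] by (simp add: power2_eq_square)
  qed
  have ortho: "X 0 t * X 1 t + Y 0 t * Y 1 t = 0" for t
  proof -
    have "((\<lambda>t. X 0 t * X 0 t + Y 0 t * Y 0 t) has_real_derivative
        2 * (X 0 t * X 1 t + Y 0 t * Y 1 t)) (at t)"
      using dX[of 0 t] dY[of 0 t] by (auto intro!: derivative_eq_intros)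
    then have "((\<lambda>t. 1) has_real_derivative 2 * (X 0 t * X 1 t + Y 0 t * Y 1 t)) (at t)"
      by (simp only: circle)
    then have "2 * (X 0 t * X 1 t + Y 0 t * Y 1 t) = 0"
      by (rule DERIV_unique) (rule DERIV_const)
    then show ?thesis
      by simp
  qed
  have ortho': "X 1 t * X 1 t + X 0 t * X 2 t + (Y 1 t * Y 1 t + Y 0 t * Y 2 t) = 0" for t
  proof -
    have "((\<lambda>t. X 0 t * X 1 t + Y 0 t * Y 1 t) has_real_derivative
        X 1 t * X 1 t + X 0 t * X 2 t + (Y 1 t * Y 1 t + Y 0 t * Y 2 t)) (at t)"
      using dX[of 0 t] dY[of 0 t] dX[of 1 t] dY[of 1 t]
      by (auto intro!: derivative_eq_intros simp: numeral_2_eq_2)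
    then have "((\<lambda>t. 0) has_real_derivative X 1 t * X 1 t + X 0 t * X 2 t + (Y 1 t * Y 1 t + Y 0 t * Y 2 t)) (at t)"
      by (simp only: ortho)
    then show ?thesis
      by (rule DERIV_unique) (rule DERIV_const)
  qed
  have area: "X i t * Y j t - Y i t * X j t = area_form ((vd ^^ i) \<gamma> t) ((vd ^^ j) \<gamma> t) / ?D"
    if "i > 0" "j > 0" for i j t
  proof -
    obtain u1 u2 v1 v2 where uv: "(vd ^^ i) \<gamma> t = (u1, u2)" "(vd ^^ j) \<gamma> t = (v1, v2)"
      by (metis surj_pair)
    have "(q * u1 - b * u2) * (a * v2 - p * v1) - (a * u2 - p * u1) * (q * v1 - b * v2)
        = ?D * (u1 * v2 - u2 * v1)"
      by algebra
    then show ?thesis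
      using that D by (simp add: X_def Y_def uv area_form_def diff_divide_distrib[symmetric])
  qed
  define \<phi> where "\<phi> t = X 0 t * Y 1 t - Y 0 t * X 1 t" for t
  have rot: "X 1 t = - (\<phi> t * Y 0 t)" "Y 1 t = \<phi> t * X 0 t" for t
    using circle[of t] ortho[of t] unfolding \<phi>_def by algebra+
  \<comment> \<open>On the unit circle |c', c''| is the cube of the angular velocity
    \<open>\<phi>\<close>, while the coordinate change divides areas by \<open>?D\<close>. Real cube
    roots are unique, so \<open>\<phi>\<close> is constant.\<close>
  have "\<phi> t ^ 3 = 1 / ?D" for t
  proof -
    have "\<phi> t ^ 3 = X 1 t * Y 2 t - Y 1 t * X 2 t"
      using ortho'[of t] circle[of t] unfolding rot by algebra
    then show ?thesis
      using area[of 1 2 t] TN[of t] by (simp add: eval_nat_numeral)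
  qed
  then have "\<phi> t = root 3 (1 / ?D)" for t
    by (metis odd_numeral odd_real_root_power_cancel)
  then obtain c where c: "\<And>t. \<phi> t = c"
    by blast
  have rot1: "X 2 t = - (c * Y 1 t)" "Y 2 t = c * X 1 t" for t
  proof -
    have "X 1 = (\<lambda>t. - (c * Y 0 t))" "Y 1 = (\<lambda>t. c * X 0 t)"
      using rot c by auto
    then have "((\<lambda>t. - (c * Y 0 t)) has_real_derivative X 2 t) (at t)"
      "((\<lambda>t. c * X 0 t) has_real_derivative Y 2 t) (at t)"
      using dX[of 1 t] dY[of 1 t] by (simp_all add: numeral_2_eq_2)
    moreover have "((\<lambda>t. - (c * Y 0 t)) has_real_derivative - (c * Y 1 t)) (at t)"
      "((\<lambda>t. c * X 0 t) has_real_derivative c * X 1 t) (at t)"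
      using dX[of 0 t] dY[of 0 t] by (auto intro!: derivative_eq_intros)
    ultimately show "X 2 t = - (c * Y 1 t)" "Y 2 t = c * X 1 t"
      by (blast intro: DERIV_unique)+
  qed
  have rot2: "X 3 t = - (c * Y 2 t)" "Y 3 t = c * X 2 t" for t
  proof -
    have "X 2 = (\<lambda>t. - (c * Y 1 t))" "Y 2 = (\<lambda>t. c * X 1 t)"
      using rot1 by auto
    then have "((\<lambda>t. - (c * Y 1 t)) has_real_derivative X 3 t) (at t)"
      "((\<lambda>t. c * X 1 t) has_real_derivative Y 3 t) (at t)"
      using dX[of 2 t] dY[of 2 t] by (simp_all add: numeral_3_eq_3 numeral_2_eq_2)
    moreover have "((\<lambda>t. - (c * Y 1 t)) has_real_derivative - (c * Y 2 t)) (at t)"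
      "((\<lambda>t. c * X 1 t) has_real_derivative c * X 2 t) (at t)"
      using dX[of 1 t] dY[of 1 t] by (auto intro!: derivative_eq_intros simp: numeral_2_eq_2)
    ultimately show "X 3 t = - (c * Y 2 t)" "Y 3 t = c * X 2 t"
      by (blast intro: DERIV_unique)+
  qed
  have "\<kappa> t = c\<^sup>2" for t
  proof -
    have "\<kappa> t / ?D = X 2 t * Y 3 t - Y 2 t * X 3 t"
      using area[of 2 3 t] by (simp add: \<kappa>_eq eval_nat_numeral)
    also have "\<dots> = c\<^sup>2 * (X 1 t * Y 2 t - Y 1 t * X 2 t)"
      unfolding rot2 rot1 by algebra
    also have "\<dots> = c\<^sup>2 / ?D"
      using area[of 1 2 t] TN[of t] by (simp add: eval_nat_numeral)
    finally show ?thesis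
      using D by simp
  qed
  then show ?thesis
    by simp
qed

text \<open>Criticality quantifies over all admissible variations, so the variation field V may have
  a tangential part. The proof exhibits a periodic primitive of the integrand built from the
  derivatives of V.\<close>

lemma critical_if_constant_curvature:
  assumes const: "\<And>t. \<kappa> t = \<kappa> 0"
  shows "critical_point total_sqrt_curv \<gamma> L"
  unfolding critical_point_def
proof (intro allI impI)
  fix \<Gamma> assume adm: "admissible_variation \<Gamma> \<gamma> L"
  define F where "F = (\<lambda>(e, t). \<Gamma> e t)"
  have \<Gamma>: "\<Gamma> e = (\<lambda>t. F (e, t))" for e
    by (simp add: F_def)
  obtain \<delta> where F: "smooth2 F" and zero: "(\<lambda>t. F (0, t)) = \<gamma>"
    and per: "\<And>e t. F (e, t + L) = F (e, t)"
    and \<delta>: "\<delta> > 0" "\<And>e. \<bar>e\<bar> < \<delta> \<Longrightarrow> strictly_pos_curved (\<lambda>t. F (e, t))"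
    using adm by (auto simp: admissible_variation_def periodic_curve_def F_def)
  define k where "k = \<kappa> 0"
  have k: "k > 0" "\<And>t. \<kappa> t = k"
    using curv_pos const by (auto simp: k_def)
  define c where "c i t = (P2 ^^ i) F (0, t)" for i t
  define V where "V i t = P1 ((P2 ^^ i) F) (0, t)" for i t
  have c: "c i = (vd ^^ i) \<gamma>" for i
    using vd_funpow_section[OF F, of i 0] by (simp add: c_def[abs_def] zero)
  \<comment> \<open>By symmetry of mixed partials, differentiating the variation field along the
    curve gives the variation of the derivatives.\<close>
  have dV: "(V i has_vector_derivative V (Suc i) t) (at t)" for i t
    using smooth2_has_P2[OF smooth2_P1[OF smooth2_P2_funpow[OF F]], of i 0 t]
    by (simp add: V_def[abs_def] P2_P1_commute smooth2_P2_funpow F)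
  have perV: "V i (t + L) = V i t" for i t
    by (simp add: V_def P1_def P2_funpow_periodic[OF F per])
  have vd_Nk: "vd N = (\<lambda>t. - k *\<^sub>R T t)"
    by (simp add: vd_N[abs_def] k)
  have "((\<lambda>t. - k *\<^sub>R T t) has_vector_derivative - k *\<^sub>R N t) (at t)" for t
    by (intro bounded_linear.has_vector_derivative[OF bounded_linear_scaleR_right] dT)
  then have "vd (vd N) = (\<lambda>t. - k *\<^sub>R N t)"
    unfolding vd_Nk by (rule vd_eqI)
  then have cs: "c 1 = T" "c 2 = N" "c 3 = (\<lambda>t. - k *\<^sub>R T t)" "c 4 = (\<lambda>t. - k *\<^sub>R N t)"
    by (simp_all add: c eval_nat_numeral vd_Nk)
  define m where "m = k powr (-1/2) / 2"
  have sqrt_k: "sqrt k = 2 * k * m"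
    using k by (simp add: m_def powr_minus_divide powr_half_sqrt real_div_sqrt)
  \<comment> \<open>With N' = - k T and \<open>sqrt k = 2 * k * m\<close>, the integrand becomes
    \<open>m / 3 * (|T,V4| + 4 |N,V3| + k |T,V2| + 4 k |N,V1|)\<close>; matching these four terms
    fixes the coefficients 1, 3 and \<open>4 * k\<close>.\<close>
  define B where "B t = m / 3 * (area_form (T t) (V 3 t) + 3 * area_form (N t) (V 2 t)
      + 4 * k * area_form (T t) (V 1 t))" for t
  have dNk: "(N has_vector_derivative - k *\<^sub>R T t) (at t)" for t
    using dN by (simp add: k)
  have dV': "(V 1 has_vector_derivative V 2 t) (at t)" "(V 2 has_vector_derivative V 3 t) (at t)"
    "(V 3 has_vector_derivative V 4 t) (at t)" for t
    using dV[of 1 t] dV[of 2 t] dV[of 3 t] by (simp_all add: eval_nat_numeral)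
  \<comment> \<open>For constant curvature the first variation of the integrand is exact.\<close>
  have dB: "(B has_real_derivative
      m * (-5/3 * k * (area_form (c 1 t) (V 2 t) + area_form (V 1 t) (c 2 t))
          + 4/3 * (area_form (c 2 t) (V 3 t) + area_form (V 2 t) (c 3 t))
          + (area_form (c 1 t) (V 4 t) + area_form (V 1 t) (c 4 t)) / 3)
        + sqrt k * (area_form (c 1 t) (V 2 t) + area_form (V 1 t) (c 2 t)) / 3) (at t)" for t
  proof -
    have "(B has_real_derivative m / 3 * ((area_form (T t) (V 4 t) + area_form (N t) (V 3 t))
        + 3 * (area_form (N t) (V 3 t) + area_form (- k *\<^sub>R T t) (V 2 t))
        + 4 * k * (area_form (T t) (V 2 t) + area_form (N t) (V 1 t)))) (at t)"
      unfolding B_def[abs_def]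
      by (intro DERIV_cmult DERIV_add has_real_derivative_area_form dT dNk dV')
    then show ?thesis
      unfolding cs sqrt_k area_form_swap[of "V _ t"]
      by (rule DERIV_cong) (simp add: area_form_simps algebra_simps add_divide_distrib diff_divide_distrib)
  qed
  have "integral {0..L} (\<lambda>t. m * (-5/3 * k * (area_form (c 1 t) (V 2 t) + area_form (V 1 t) (c 2 t))
          + 4/3 * (area_form (c 2 t) (V 3 t) + area_form (V 2 t) (c 3 t))
          + (area_form (c 1 t) (V 4 t) + area_form (V 1 t) (c 4 t)) / 3)
        + sqrt k * (area_form (c 1 t) (V 2 t) + area_form (V 1 t) (c 2 t)) / 3) = B L - B 0"
    by (intro integral_unique fundamental_theorem_of_calculus)
      (use L_pos dB in \<open>auto simp: has_real_derivative_iff_has_vector_derivative[symmetric]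
        intro: has_field_derivative_at_within\<close>)
  also have "B L = B 0"
    using perV[of _ 0] vd_periodic[of 1 0] vd_periodic[of 2 0] by (simp add: B_def eval_nat_numeral)
  finally have int0: "integral {0..L} (\<lambda>t. m * (-5/3 * k * (area_form (c 1 t) (V 2 t) + area_form (V 1 t) (c 2 t))
          + 4/3 * (area_form (c 2 t) (V 3 t) + area_form (V 2 t) (c 3 t))
          + (area_form (c 1 t) (V 4 t) + area_form (V 1 t) (c 4 t)) / 3)
        + sqrt k * (area_form (c 1 t) (V 2 t) + area_form (V 1 t) (c 2 t)) / 3) = 0"
    by (simp only: diff_self)
  have "((\<lambda>e. curv_integral sqrt L (\<lambda>t. F (e, t))) has_real_derivative 0) (at 0)"
  proof -
    have unit: "affine_speed (c 0) t = 1" for t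
      by (simp add: c unit_speed)
    have d_sqrt: "(sqrt has_real_derivative x powr (- 1 / 2) / 2) (at x)" if "x > 0" for x :: real
      using DERIV_real_sqrt[OF that] that by (simp add: powr_minus powr_half_sqrt)
    have cont: "continuous_on {0<..} (\<lambda>x :: real. x powr (- 1 / 2) / 2)"
      by (intro continuous_intros) auto
    have c0: "aff_curv (c 0) t = k" for t
      by (simp add: c k)
    show ?thesis
      using first_variation_curv_integral[OF F \<delta> unit[unfolded c_def] d_sqrt cont, of L]
      unfolding c_def[symmetric] V_def[symmetric] c0 m_def[symmetric] int0 .
  qed
  then show "deriv (\<lambda>e. total_sqrt_curv L (\<Gamma> e)) 0 = 0"
    unfolding total_sqrt_curv_eq \<Gamma> by (rule DERIV_imp_deriv)
qed

end

text \<open>The multiplier 0 works for every \<open>G\<close>, so the variation of a constraint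
  along a general variation never has to be computed.\<close>

lemma critical_point_imp_under: "critical_point F \<gamma> L \<Longrightarrow> critical_point_under F G \<gamma> L"
  unfolding critical_point_def critical_point_under_def by (intro exI[of _ 0]) simp

theorem theorem7:
  fixes \<gamma> :: "real \<Rightarrow> real \<times> real" and L :: real
  assumes "L > 0"
    and "smooth_curve \<gamma>"
    and "periodic_curve \<gamma> L"
    and "inj_on \<gamma> {0..<L}"
    and "\<forall>t. affine_speed \<gamma> t = 1"
    and "\<forall>t. aff_curv \<gamma> t > 0"
  shows "(critical_point total_sqrt_curv \<gamma> L \<longleftrightarrow> is_ellipse \<gamma>)
       \<and> (critical_point_under total_sqrt_curv enclosed_area \<gamma> L \<longleftrightarrow> is_ellipse \<gamma>)
       \<and> (critical_point_under total_sqrt_curv affine_length \<gamma> L \<longleftrightarrow> is_ellipse \<gamma>)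
       \<and> (critical_point_under total_sqrt_curv total_curv \<gamma> L \<longleftrightarrow> is_ellipse \<gamma>)"
proof -
  interpret simple_unit_speed_curve \<gamma> L
    using assms by unfold_locales auto
  obtain s where area: "integral {0..L} (\<lambda>t. area_form (\<gamma> t - \<gamma> s) (T t)) \<noteq> 0"
    using support_integral_nonzero by blast
  have ellipse: "is_ellipse \<gamma>"
    if "critical_point_under total_sqrt_curv enclosed_area \<gamma> L
      \<or> critical_point_under total_sqrt_curv affine_length \<gamma> L
      \<or> critical_point_under total_sqrt_curv total_curv \<gamma> L"
    using that critical_area_imp_constant[OF _ area] critical_affine_length_imp_constant
      critical_total_curv_imp_constant is_ellipse_if_constant_curvature by blast
  have critical: "critical_point total_sqrt_curv \<gamma> L" if "is_ellipse \<gamma>"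
    using constant_curvature_if_is_ellipse[OF that] by (rule critical_if_constant_curvature)
  have under: "critical_point_under total_sqrt_curv G \<gamma> L"
    if "critical_point total_sqrt_curv \<gamma> L" for G
    using that by (rule critical_point_imp_under)
  \<comment> \<open>The implications form a cycle for each constraint: critical, critical under the
    constraint, ellipse, critical.\<close>
  show ?thesis
    using ellipse critical under by blast
qed

end
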